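(* Let $\Bbbk$ be an algebraically closed field, let $A$ be the Kronecker algebra over $\Bbbk$, and let $M$ be a finite-dimensional $A$-module with dimension vector $(d_1,d_2)$. Let $M=P_M\oplus R_M\oplus I_M$ be a decomposition of $M$ into its preprojective, regular and preinjective parts. If $\{f_1,\dots,f_a\}$ is a basis of $\operatorname{Hom}_A(M,P_{d_2})$, then $$\bigcap_{i=1}^a\operatorname{Ker}f_i=R_M\oplus I_M,\qquad\text{and hence}\qquad P_M\cong M\Big/\Big(\bigcap_{i=1}^a\operatorname{Ker}f_i\Big).$$
   Context: The Kronecker algebra $A$ is the path algebra over $\Bbbk$ of the quiver with two vertices $1,2$ and two arrows $\alpha,\beta\colon1\to2$. Finite-dimensional $A$-modules are identified with representations $M=(M(\alpha),M(\beta))$ of this quiver, where with $\underline{\dim}M=(\dim M(1),\dim M(2))=(d_1,d_2)$ the $M(\alpha),M(\beta)$ are $d_2\times d_1$ matrices (empty matrices allowed). A complete list $\mathcal{L}=\mathcal{P}\cup\mathcal{R}\cup\mathcal{I}$ of representatives of isoclasses of indecomposable $A$-modules is: preprojectives $\mathcal{P}=\{P_n\mid n\ge1\}$ with $P_n=\left(\begin{bmatrix}E_{n-1}\\ 0\end{bmatrix},\begin{bmatrix}0\\ E_{n-1}\end{bmatrix}\right)$ (size $n\times(n-1)$); preinjectives $\mathcal{I}=\{I_n\mid n\ge1\}$ with $I_n=([E_{n-1}\ 0],[0\ E_{n-1}])$ (size $(n-1)\times n$); regulars $\mathcal{R}=\{R_n(\lambda)=(E_n,J_n(\lambda)),\ R_n(\infty)=(J_n(0),E_n)\mid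 n\ge1,\lambda\in\Bbbk\}$, with $E_n$ the identity matrix and $J_n(\lambda)$ the (upper triangular) Jordan cell of size $n$ with eigenvalue $\lambda$. Convention: $P_0=0$. The map $\boldsymbol{d}_M\colon\mathcal{L}\to\mathbb{N}_0$ is the unique one with $M\cong\bigoplus_{L\in\mathcal{L}}L^{(\boldsymbol{d}_M(L))}$. Fix an isomorphism $F\colon\bigoplus_{L\in\mathcal{L}}L^{(\boldsymbol{d}_M(L))}\to M$; the submodules $P_M,R_M,I_M$ of $M$ are the images under $F$ of $\bigoplus_{L\in\mathcal{P}}L^{(\boldsymbol{d}_M(L))}$, $\bigoplus_{L\in\mathcal{R}}L^{(\boldsymbol{d}_M(L))}$, $\bigoplus_{L\in\mathcal{I}}L^{(\boldsymbol{d}_M(L))}$ respectively. An empty intersection of submodules of $M$ is $M$. *)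

theory Defs
  imports
    "Jordan_Normal_Form.VS_Connect"
    "Jordan_Normal_Form.Jordan_Normal_Form"
    "HOL-Computational_Algebra.Polynomial"
    "HOL-Algebra.AbelCoset"
begin

hide_const (open) Multiset.mult Polynomial.smult Modules.module Modules.module_hom

text \<open>
  Modules over the Kronecker algebra are treated as representations of the quiver with vertices
  1, 2 and arrows alpha, beta from 1 to 2: two vector spaces and two linear maps. The ground
  field is the type \<^typ>\<open>'a\<close>, seen as a carrier ring through \<^const>\<open>class_ring\<close>.
\<close>

record ('a, 'u, 'v) kronecker =
  space1 :: "('a, 'u) module"
  space2 :: "('a, 'v) module"
  alpha :: "'u \<Rightarrow> 'v"
  beta :: "'u \<Rightarrow> 'v"

definition kron_module :: "('a::field, 'u, 'v) kronecker \<Rightarrow> bool" where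
  "kron_module M \<longleftrightarrow>
     vectorspace class_ring (space1 M) \<and> vectorspace class_ring (space2 M) \<and>
     alpha M \<in> module_hom class_ring (space1 M) (space2 M) \<and>
     beta M \<in> module_hom class_ring (space1 M) (space2 M)"

definition kron_fin_dim :: "('a::field, 'u, 'v) kronecker \<Rightarrow> bool" where
  "kron_fin_dim M \<longleftrightarrow>
     vectorspace.fin_dim class_ring (space1 M) \<and> vectorspace.fin_dim class_ring (space2 M)"

definition dim_vector :: "('a::field, 'u, 'v) kronecker \<Rightarrow> nat \<times> nat" where
  "dim_vector M =
     (vectorspace.dim class_ring (space1 M), vectorspace.dim class_ring (space2 M))"


section \<open>Homomorphisms\<close>

text \<open>Homomorphisms are pairs of functions made extensional on the carriers, so that equality
  in \<open>kron_hom\<close> is equality of homomorphisms.\<close>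

definition kron_hom ::
  "('a::field, 'u, 'v) kronecker \<Rightarrow> ('a, 'w, 'x) kronecker \<Rightarrow> (('u \<Rightarrow> 'w) \<times> ('v \<Rightarrow> 'x)) set" where
  "kron_hom M N = {(f1, f2).
     f1 \<in> module_hom class_ring (space1 M) (space1 N) \<and> f1 \<in> extensional (carrier (space1 M)) \<and>
     f2 \<in> module_hom class_ring (space2 M) (space2 N) \<and> f2 \<in> extensional (carrier (space2 M)) \<and>
     (\<forall>x\<in>carrier (space1 M). f2 (alpha M x) = alpha N (f1 x) \<and> f2 (beta M x) = beta N (f1 x))}"

definition kron_hom_space ::
  "('a::field, 'u, 'v) kronecker \<Rightarrow> ('a, 'w, 'x) kronecker \<Rightarrow> ('a, ('u \<Rightarrow> 'w) \<times> ('v \<Rightarrow> 'x)) module" where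
  "kron_hom_space M N = \<lparr>
     carrier = kron_hom M N,
     mult = undefined,
     one = undefined,
     zero = (\<lambda>x\<in>carrier (space1 M). \<zero>\<^bsub>space1 N\<^esub>, \<lambda>y\<in>carrier (space2 M). \<zero>\<^bsub>space2 N\<^esub>),
     add = (\<lambda>f g. (\<lambda>x\<in>carrier (space1 M). fst f x \<oplus>\<^bsub>space1 N\<^esub> fst g x,
                   \<lambda>y\<in>carrier (space2 M). snd f y \<oplus>\<^bsub>space2 N\<^esub> snd g y)),
     smult = (\<lambda>c f. (\<lambda>x\<in>carrier (space1 M). c \<odot>\<^bsub>space1 N\<^esub> fst f x,
                     \<lambda>y\<in>carrier (space2 M). c \<odot>\<^bsub>space2 N\<^esub> snd f y))\<rparr>"

definition kron_iso ::
  "('a::field, 'u, 'v) kronecker \<Rightarrow> ('a, 'w, 'x) kronecker \<Rightarrow> (('u \<Rightarrow> 'w) \<times> ('v \<Rightarrow> 'x)) set" where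
  "kron_iso M N = {f \<in> kron_hom M N.
     bij_betw (fst f) (carrier (space1 M)) (carrier (space1 N)) \<and>
     bij_betw (snd f) (carrier (space2 M)) (carrier (space2 N))}"

definition kron_isomorphic ::
  "('a::field, 'u, 'v) kronecker \<Rightarrow> ('a, 'w, 'x) kronecker \<Rightarrow> bool" where
  "kron_isomorphic M N \<longleftrightarrow> kron_iso M N \<noteq> {}"


section \<open>Submodules and quotients\<close>

text \<open>A submodule of \<open>M\<close> is given by its two underlying sets.\<close>

definition kron_ker ::
  "('a, 'u, 'v) kronecker \<Rightarrow> ('a, 'w, 'x) kronecker \<Rightarrow> ('u \<Rightarrow> 'w) \<times> ('v \<Rightarrow> 'x) \<Rightarrow> 'u set \<times> 'v set" where
  "kron_ker M N f = (a_kernel (space1 M) (space1 N) (fst f), a_kernel (space2 M) (space2 N) (snd f))"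

text \<open>Intersecting with the carriers makes the empty intersection equal to \<open>M\<close>.\<close>

definition kron_Inter ::
  "('a, 'u, 'v) kronecker \<Rightarrow> 'i set \<Rightarrow> ('i \<Rightarrow> 'u set \<times> 'v set) \<Rightarrow> 'u set \<times> 'v set" where
  "kron_Inter M I U = (carrier (space1 M) \<inter> (\<Inter>i\<in>I. fst (U i)), carrier (space2 M) \<inter> (\<Inter>i\<in>I. snd (U i)))"

text \<open>\<open>kron_is_direct_sum M W U V\<close>: the submodule \<open>W\<close> of \<open>M\<close> is the internal direct sum of the
  submodules \<open>U\<close> and \<open>V\<close>.\<close>

definition kron_is_direct_sum ::
  "('a, 'u, 'v) kronecker \<Rightarrow> 'u set \<times> 'v set \<Rightarrow> 'u set \<times> 'v set \<Rightarrow> 'u set \<times> 'v set \<Rightarrow> bool" where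
  "kron_is_direct_sum M W U V \<longleftrightarrow>
     W = (fst U <+>\<^bsub>space1 M\<^esub> fst V, snd U <+>\<^bsub>space2 M\<^esub> snd V) \<and>
     fst U \<inter> fst V = {\<zero>\<^bsub>space1 M\<^esub>} \<and> snd U \<inter> snd V = {\<zero>\<^bsub>space2 M\<^esub>}"

definition kron_sub ::
  "('a, 'u, 'v) kronecker \<Rightarrow> 'u set \<times> 'v set \<Rightarrow> ('a, 'u, 'v) kronecker" where
  "kron_sub M U = M\<lparr>space1 := (space1 M)\<lparr>carrier := fst U\<rparr>, space2 := (space2 M)\<lparr>carrier := snd U\<rparr>\<rparr>"

text \<open>In the quotients below the union over the representatives \<open>x\<close> of a coset \<open>X\<close> is a union of
  equal cosets, so it is the well-defined induced operation.\<close>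

definition quot_space :: "('a, 'u) module \<Rightarrow> 'u set \<Rightarrow> ('a, 'u set) module" where
  "quot_space V U = \<lparr>
     carrier = a_rcosets\<^bsub>V\<^esub> U,
     mult = undefined,
     one = undefined,
     zero = U,
     add = set_add V,
     smult = (\<lambda>c X. \<Union>x\<in>X. U +>\<^bsub>V\<^esub> (c \<odot>\<^bsub>V\<^esub> x))\<rparr>"

definition kron_quot ::
  "('a, 'u, 'v) kronecker \<Rightarrow> 'u set \<times> 'v set \<Rightarrow> ('a, 'u set, 'v set) kronecker" where
  "kron_quot M U = \<lparr>
     space1 = quot_space (space1 M) (fst U),
     space2 = quot_space (space2 M) (snd U),
     alpha = (\<lambda>X. \<Union>x\<in>X. snd U +>\<^bsub>space2 M\<^esub> alpha M x),
     beta = (\<lambda>X. \<Union>x\<in>X. snd U +>\<^bsub>space2 M\<^esub> beta M x)\<rparr>"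


section \<open>External direct sums\<close>

definition dsum_space :: "'i set \<Rightarrow> ('i \<Rightarrow> ('a, 'u) module) \<Rightarrow> ('a, 'i \<Rightarrow> 'u) module" where
  "dsum_space I V = \<lparr>
     carrier = {x \<in> (\<Pi>\<^sub>E i\<in>I. carrier (V i)). finite {i \<in> I. x i \<noteq> \<zero>\<^bsub>V i\<^esub>}},
     mult = undefined,
     one = undefined,
     zero = (\<lambda>i\<in>I. \<zero>\<^bsub>V i\<^esub>),
     add = (\<lambda>x y. \<lambda>i\<in>I. x i \<oplus>\<^bsub>V i\<^esub> y i),
     smult = (\<lambda>c x. \<lambda>i\<in>I. c \<odot>\<^bsub>V i\<^esub> x i)\<rparr>"

definition kron_dsum ::
  "'i set \<Rightarrow> ('i \<Rightarrow> ('a, 'u, 'v) kronecker) \<Rightarrow> ('a, 'i \<Rightarrow> 'u, 'i \<Rightarrow> 'v) kronecker" where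
  "kron_dsum I N = \<lparr>
     space1 = dsum_space I (\<lambda>i. space1 (N i)),
     space2 = dsum_space I (\<lambda>i. space2 (N i)),
     alpha = (\<lambda>x. \<lambda>i\<in>I. alpha (N i) (x i)),
     beta = (\<lambda>x. \<lambda>i\<in>I. beta (N i) (x i))\<rparr>"


section \<open>The indecomposable modules\<close>

text \<open>A pair of \<open>d2 \<times> d1\<close> matrices, either dimension possibly 0, acting on column vectors.\<close>

definition mat_kron :: "'a::field mat \<times> 'a mat \<Rightarrow> ('a, 'a vec, 'a vec) kronecker" where
  "mat_kron L = \<lparr>
     space1 = module_vec TYPE('a) (dim_col (fst L)),
     space2 = module_vec TYPE('a) (dim_row (fst L)),
     alpha = (*\<^sub>v) (fst L),
     beta = (*\<^sub>v) (snd L)\<rparr>"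

text \<open>For \<open>n = 0\<close> the truncated subtraction makes \<open>preproj 0\<close> a pair of \<open>0 \<times> 0\<close> matrices, so it is
  the zero module, as it should be.\<close>

definition preproj :: "nat \<Rightarrow> 'a::field mat \<times> 'a mat" where
  "preproj n = (mat n (n - 1) (\<lambda>(i, j). if i = j then 1 else 0),
                mat n (n - 1) (\<lambda>(i, j). if i = Suc j then 1 else 0))"

definition preinj :: "nat \<Rightarrow> 'a::field mat \<times> 'a mat" where
  "preinj n = (mat (n - 1) n (\<lambda>(i, j). if i = j then 1 else 0),
               mat (n - 1) n (\<lambda>(i, j). if Suc i = j then 1 else 0))"

definition regular :: "nat \<Rightarrow> 'a::field \<Rightarrow> 'a mat \<times> 'a mat" where
  "regular n c = (1\<^sub>m n, jordan_block n c)"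

definition regular_inf :: "nat \<Rightarrow> 'a::field mat \<times> 'a mat" where
  "regular_inf n = (jordan_block n 0, 1\<^sub>m n)"

definition preprojectives :: "('a::field mat \<times> 'a mat) set" where
  "preprojectives = {preproj n | n. n \<ge> 1}"

definition regulars :: "('a::field mat \<times> 'a mat) set" where
  "regulars = {regular n c | n c. n \<ge> 1} \<union> {regular_inf n | n. n \<ge> 1}"

definition preinjectives :: "('a::field mat \<times> 'a mat) set" where
  "preinjectives = {preinj n | n. n \<ge> 1}"

definition indecomposables :: "('a::field mat \<times> 'a mat) set" where
  "indecomposables = preprojectives \<union> regulars \<union> preinjectives"


section \<open>Decompositions into indecomposables\<close>

definition summands :: "('a::field mat \<times> 'a mat \<Rightarrow> nat) \<Rightarrow> (('a mat \<times> 'a mat) \<times> nat) set" where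
  "summands d = {(L, j). L \<in> indecomposables \<and> j < d L}"

text \<open>The direct sum over all indecomposables \<open>L\<close> of \<open>d L\<close> copies of \<open>L\<close>. An
  isomorphism from it to a module \<open>M\<close> says that \<open>d\<close>, on the indecomposables, is the multiplicity
  function of \<open>M\<close>.\<close>

definition mult_dsum ::
  "('a::field mat \<times> 'a mat \<Rightarrow> nat) \<Rightarrow>
   ('a, ('a mat \<times> 'a mat) \<times> nat \<Rightarrow> 'a vec, ('a mat \<times> 'a mat) \<times> nat \<Rightarrow> 'a vec) kronecker" where
  "mult_dsum d = kron_dsum (summands d) (\<lambda>(L, j). mat_kron L)"

text \<open>The image under \<open>F\<close> of the partial direct sum over the \<open>L\<close> in \<open>S\<close>, which sits inside
  \<open>mult_dsum d\<close> as the families vanishing at all other summands.\<close>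

definition part_of ::
  "('a::field mat \<times> 'a mat \<Rightarrow> nat) \<Rightarrow>
   ((('a mat \<times> 'a mat) \<times> nat \<Rightarrow> 'a vec) \<Rightarrow> 'u) \<times> ((('a mat \<times> 'a mat) \<times> nat \<Rightarrow> 'a vec) \<Rightarrow> 'v) \<Rightarrow>
   ('a mat \<times> 'a mat) set \<Rightarrow> 'u set \<times> 'v set" where
  "part_of d F S =
     (fst F ` {x \<in> carrier (space1 (mult_dsum d)).
                 \<forall>(L, j)\<in>summands d. L \<notin> S \<longrightarrow> x (L, j) = \<zero>\<^bsub>space1 (mat_kron L)\<^esub>},
      snd F ` {x \<in> carrier (space2 (mult_dsum d)).
                 \<forall>(L, j)\<in>summands d. L \<notin> S \<longrightarrow> x (L, j) = \<zero>\<^bsub>space2 (mat_kron L)\<^esub>})"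

end

(* The common kernel of a basis of Hom(M, P_m) is the common kernel of all homomorphisms M -> P_m,
   where m = d2. It contains every regular and every preinjective summand, because a homomorphism
   to P_m vanishes on any submodule on which alpha or beta is onto: for R_n(c) and I_n this is alpha,
   for R_n(infinity) it is beta. It meets the preprojective part trivially, because a summand P_n of M
   satisfies n <= d2 and P_n embeds into P_m by padding with zeros, so that the projection to the
   summand followed by this embedding is a homomorphism M -> P_m. *)

theory Submission
  imports Defs
begin

section \<open>Module homomorphisms and direct sums\<close>

text \<open>In general no single arrow is onto on the whole of R_M + I_M: \<open>alpha\<close> is a
  nilpotent Jordan block on R_n(infinity), and \<open>beta\<close> is one on R_n(0). The vanishing
  argument needs one arrow that is onto on the submodule considered. So the summands outside P_M are
  split into those with \<open>alpha\<close> onto and the rest, where \<open>beta\<close> is onto;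
  additivity joins the two halves. The bound n \<le> d2 comes from vertex 2: the component of M at a
  summand P_n maps \<open>space2 M\<close> onto a space of dimension n. The embedding of P_n into
  P_m is transparent when coordinate vectors are read as polynomials: the two spaces of P_m are the
  polynomials of degree < m - 1 and of degree < m, \<open>alpha\<close> is the inclusion and
  \<open>beta\<close> is multiplication by X. Padding is the inclusion of the polynomials of smaller
  degree, which commutes with both.\<close>

lemma module_homI:
  assumes "\<And>x. x \<in> carrier V \<Longrightarrow> h x \<in> carrier W"
    and "\<And>x y. x \<in> carrier V \<Longrightarrow> y \<in> carrier V \<Longrightarrow> h (x \<oplus>\<^bsub>V\<^esub> y) = h x \<oplus>\<^bsub>W\<^esub> h y"
    and "\<And>c x. c \<in> carrier R \<Longrightarrow> x \<in> carrier V \<Longrightarrow> h (c \<odot>\<^bsub>V\<^esub> x) = c \<odot>\<^bsub>W\<^esub> h x"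
  shows "h \<in> module_hom R V W"
  using assms unfolding LinearCombinations.module_hom_def by auto

lemma module_homD:
  assumes "h \<in> module_hom R V W"
  shows "\<And>x. x \<in> carrier V \<Longrightarrow> h x \<in> carrier W"
    and "\<And>x y. x \<in> carrier V \<Longrightarrow> y \<in> carrier V \<Longrightarrow> h (x \<oplus>\<^bsub>V\<^esub> y) = h x \<oplus>\<^bsub>W\<^esub> h y"
    and "\<And>c x. c \<in> carrier R \<Longrightarrow> x \<in> carrier V \<Longrightarrow> h (c \<odot>\<^bsub>V\<^esub> x) = c \<odot>\<^bsub>W\<^esub> h x"
  using assms unfolding LinearCombinations.module_hom_def by auto

lemma module_hom_zero:
  assumes "module R V" "module R W" "h \<in> module_hom R V W"
  shows "h \<zero>\<^bsub>V\<^esub> = \<zero>\<^bsub>W\<^esub>"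
  using assms by (intro mod_hom.f0_is_0[of R V W h] mod_hom.intro mod_hom_axioms.intro)

text \<open>Members of \<open>kron_hom\<close> must be extensional, so every map built below is cut
  down to the carrier; linearity survives because the carrier is closed under the
  operations.\<close>

lemma module_hom_restrict:
  assumes "module R V" "h \<in> module_hom R V W"
  shows "restrict h (carrier V) \<in> module_hom R V W"
proof -
  interpret V: Module.module R V by fact
  show ?thesis
    by (rule module_homI) (simp_all add: module_homD[OF assms(2)])
qed

lemma module_hom_restrict_comp:
  assumes "module R V" "g \<in> module_hom R V W" "h \<in> module_hom R W X"
  shows "(\<lambda>x\<in>carrier V. h (g x)) \<in> module_hom R V X"
proof -
  interpret V: Module.module R V by fact
  show ?thesis
    by (rule module_homI) (simp_all add: module_homD[OF assms(2)] module_homD[OF assms(3)])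
qed

lemma module_hom_inv_into:
  assumes "module R V" "h \<in> module_hom R V W" and bij: "bij_betw h (carrier V) (carrier W)"
  shows "inv_into (carrier V) h \<in> module_hom R W V"
proof -
  interpret V: Module.module R V by fact
  note h = module_homD[OF assms(2)]
  let ?k = "inv_into (carrier V) h"
  have inj: "inj_on h (carrier V)" using bij by (rule bij_betw_imp_inj_on)
  have k: "?k y \<in> carrier V" "h (?k y) = y" if "y \<in> carrier W" for y
    using bij_betw_inv_into_right[OF bij that] that bij bij_betw_imp_surj_on[OF bij]
    by (auto intro: inv_into_into)
  have kI: "?k y = x" if "x \<in> carrier V" "h x = y" for x y
    using inv_into_f_eq[OF inj that] .
  show ?thesis
    by (rule module_homI) (auto intro!: kI simp: k h)
qed

lemma image_submodule:
  assumes "module R V" "module R W" "h \<in> module_hom R V W" "submodule R U V"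
  shows "submodule R (h ` U) W"
proof -
  interpret U: submodule R U V by fact
  note h = module_homD[OF assms(3)]
  note U = U.subset[THEN subsetD]
  show ?thesis
  proof (rule submodule.intro)
    show "\<zero>\<^bsub>W\<^esub> \<in> h ` U"
      using module_hom_zero[OF assms(1-3)] U.zero_closed by (metis imageI)
    show "v \<oplus>\<^bsub>W\<^esub> w \<in> h ` U" if "v \<in> h ` U" "w \<in> h ` U" for v w
      using that by (auto simp flip: h(2) simp: U)
    show "c \<odot>\<^bsub>W\<^esub> v \<in> h ` U" if "c \<in> carrier R" "v \<in> h ` U" for c v
      using that by (auto simp flip: h(3) simp: U)
  qed (use assms U h in auto)
qed

section \<open>External direct sums and families concentrated on part of the index set\<close>

lemma dsum_space_sel [simp]:
  "carrier (dsum_space I V) = {x \<in> (\<Pi>\<^sub>E i\<in>I. carrier (V i)). finite {i \<in> I. x i \<noteq> \<zero>\<^bsub>V i\<^esub>}}"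
  "\<zero>\<^bsub>dsum_space I V\<^esub> = (\<lambda>i\<in>I. \<zero>\<^bsub>V i\<^esub>)"
  "x \<oplus>\<^bsub>dsum_space I V\<^esub> y = (\<lambda>i\<in>I. x i \<oplus>\<^bsub>V i\<^esub> y i)"
  "c \<odot>\<^bsub>dsum_space I V\<^esub> x = (\<lambda>i\<in>I. c \<odot>\<^bsub>V i\<^esub> x i)"
  by (simp_all add: dsum_space_def)

text \<open>The laws hold componentwise; what needs care is finite support. The support of a sum
  lies in the union of the two supports, and negatives and scalar multiples create no new nonzero
  components.\<close>

lemma dsum_space_module:
  assumes R: "cring R" and V: "\<And>i. i \<in> I \<Longrightarrow> module R (V i)"
  shows "module R (dsum_space I V)"
proof -
  have G: "abelian_group (V i)" if "i \<in> I" for i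
    using V[OF that] by (rule Module.module.axioms)
  note V_simps = abelian_monoid.a_closed[OF abelian_group.axioms(1)[OF G]]
    abelian_monoid.zero_closed[OF abelian_group.axioms(1)[OF G]]
    abelian_monoid.l_zero[OF abelian_group.axioms(1)[OF G]]
    Module.module.smult_closed[OF V]
  have neg_zero: "\<ominus>\<^bsub>V i\<^esub> \<zero>\<^bsub>V i\<^esub> = \<zero>\<^bsub>V i\<^esub>" if "i \<in> I" for i
    using abelian_group.r_neg[OF G[OF that], of "\<zero>\<^bsub>V i\<^esub>"] V_simps that
    by (simp add: abelian_group.a_inv_closed[OF G])
  have fin: "finite {i \<in> I. x i \<oplus>\<^bsub>V i\<^esub> y i \<noteq> \<zero>\<^bsub>V i\<^esub>}"
    if "finite {i \<in> I. x i \<noteq> \<zero>\<^bsub>V i\<^esub>}" "finite {i \<in> I. y i \<noteq> \<zero>\<^bsub>V i\<^esub>}" for x y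
    by (rule finite_subset[OF _ finite_UnI[OF that]]) (auto simp: V_simps)
  have fin_smult: "finite {i \<in> I. c \<odot>\<^bsub>V i\<^esub> x i \<noteq> \<zero>\<^bsub>V i\<^esub>}"
    if "finite {i \<in> I. x i \<noteq> \<zero>\<^bsub>V i\<^esub>}" "c \<in> carrier R" for x c
    by (rule finite_subset[OF _ that(1)]) (use that(2) in \<open>auto simp: Module.module.smult_r_null[OF V]\<close>)
  show ?thesis
  proof (rule moduleI[OF R abelian_groupI])
    fix x assume x: "x \<in> carrier (dsum_space I V)"
    show "\<exists>y\<in>carrier (dsum_space I V). y \<oplus>\<^bsub>dsum_space I V\<^esub> x = \<zero>\<^bsub>dsum_space I V\<^esub>"
    proof (rule bexI[of _ "\<lambda>i\<in>I. \<ominus>\<^bsub>V i\<^esub> x i"])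
      have "finite {i \<in> I. \<ominus>\<^bsub>V i\<^esub> x i \<noteq> \<zero>\<^bsub>V i\<^esub>}"
        by (rule finite_subset[of _ "{i \<in> I. x i \<noteq> \<zero>\<^bsub>V i\<^esub>}"])
           (use x in \<open>auto simp: neg_zero\<close>)
      then show "(\<lambda>i\<in>I. \<ominus>\<^bsub>V i\<^esub> x i) \<in> carrier (dsum_space I V)"
        using x by (auto simp: PiE_iff abelian_group.a_inv_closed[OF G] cong: conj_cong)
    qed (use x in \<open>auto simp: PiE_iff abelian_group.l_neg[OF G]\<close>)
  next
    fix x y z
    assume "x \<in> carrier (dsum_space I V)" "y \<in> carrier (dsum_space I V)" "z \<in> carrier (dsum_space I V)"
    then show "x \<oplus>\<^bsub>dsum_space I V\<^esub> y \<oplus>\<^bsub>dsum_space I V\<^esub> z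
        = x \<oplus>\<^bsub>dsum_space I V\<^esub> (y \<oplus>\<^bsub>dsum_space I V\<^esub> z)"
      by (auto simp: PiE_iff abelian_monoid.a_assoc[OF abelian_group.axioms(1)[OF G]])
  next
    fix x y assume "x \<in> carrier (dsum_space I V)" "y \<in> carrier (dsum_space I V)"
    then show "x \<oplus>\<^bsub>dsum_space I V\<^esub> y = y \<oplus>\<^bsub>dsum_space I V\<^esub> x"
      by (auto simp: PiE_iff abelian_monoid.a_comm[OF abelian_group.axioms(1)[OF G]])
  qed (auto simp: PiE_iff V_simps fin fin_smult Module.module.smult_assoc1[OF V] Module.module.smult_l_distr[OF V]
        Module.module.smult_r_distr[OF V] Module.module.smult_one[OF V]
        extensional_def fun_eq_iff cong: conj_cong)
qed

text \<open>The partial direct sum over \<open>I \<inter> J\<close>. Only indices in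
  \<open>I\<close> are tested, so \<open>J\<close> may be any set, such as a complement or the set
  of all pairs whose first entry lies in a given class.\<close>

definition supported :: "'i set \<Rightarrow> ('i \<Rightarrow> ('a, 'u) module) \<Rightarrow> 'i set \<Rightarrow> ('i \<Rightarrow> 'u) set" where
  "supported I V J = {x \<in> carrier (dsum_space I V). \<forall>i\<in>I. i \<notin> J \<longrightarrow> x i = \<zero>\<^bsub>V i\<^esub>}"

lemma supported_submodule:
  assumes R: "cring R" and V: "\<And>i. i \<in> I \<Longrightarrow> module R (V i)"
  shows "submodule R (supported I V J) (dsum_space I V)"
proof -
  interpret D: Module.module R "dsum_space I V" by (rule dsum_space_module[OF assms])
  have z: "\<zero>\<^bsub>V i\<^esub> \<oplus>\<^bsub>V i\<^esub> \<zero>\<^bsub>V i\<^esub> = \<zero>\<^bsub>V i\<^esub>" if "i \<in> I" for i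
    using abelian_monoid.l_zero abelian_monoid.zero_closed abelian_group.axioms(1)
      Module.module.axioms(2)[OF V[OF that]] by metis
  show ?thesis
  proof (rule submodule.intro)
    show "module R (dsum_space I V)" ..
    show "\<zero>\<^bsub>dsum_space I V\<^esub> \<in> supported I V J"
      using D.M.zero_closed by (simp add: supported_def del: dsum_space_sel(1))
    show "v \<oplus>\<^bsub>dsum_space I V\<^esub> w \<in> supported I V J"
      if "v \<in> supported I V J" "w \<in> supported I V J" for v w
      using that D.M.a_closed[of v w] z by (simp add: supported_def del: dsum_space_sel(1))
    show "c \<odot>\<^bsub>dsum_space I V\<^esub> v \<in> supported I V J"
      if "c \<in> carrier R" "v \<in> supported I V J" for c v
      using that D.smult_closed[of c v]
      by (simp add: supported_def Module.module.smult_r_null[OF V] del: dsum_space_sel(1))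
  qed (auto simp: supported_def)
qed

lemma supported_cong: "I \<inter> J = I \<inter> J' \<Longrightarrow> supported I V J = supported I V J'"
  unfolding supported_def by blast

lemma supported_UNIV: "supported I V UNIV = carrier (dsum_space I V)"
  unfolding supported_def by auto

lemma supported_Int:
  assumes R: "cring R" and V: "\<And>i. i \<in> I \<Longrightarrow> module R (V i)" and "I \<inter> J \<inter> J' = {}"
  shows "supported I V J \<inter> supported I V J' = {\<zero>\<^bsub>dsum_space I V\<^esub>}"
proof -
  let ?z = "\<zero>\<^bsub>dsum_space I V\<^esub>"
  have "x = ?z" if x: "x \<in> supported I V J" "x \<in> supported I V J'" for x
  proof
    fix i
    show "x i = ?z i"
    proof (cases "i \<in> I")
      case True
      then have "i \<notin> J \<or> i \<notin> J'" using assms(3) by blast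
      then have "x i = \<zero>\<^bsub>V i\<^esub>"
        using x True unfolding supported_def by blast
      then show ?thesis using True by simp
    next
      case False
      have "x \<in> extensional I" using x(1) unfolding supported_def dsum_space_sel PiE_def by blast
      then show ?thesis using False by (simp add: extensional_def)
    qed
  qed
  moreover have "?z \<in> supported I V J" "?z \<in> supported I V J'"
    by (rule submodule.zero_closed[OF supported_submodule[OF R V]], assumption)+
  ultimately show ?thesis by blast
qed

lemma supported_Un:
  assumes R: "cring R" and V: "\<And>i. i \<in> I \<Longrightarrow> module R (V i)"
  shows "supported I V (J \<union> J') = supported I V J <+>\<^bsub>dsum_space I V\<^esub> supported I V J'"
proof (intro equalityI subsetI)
  fix x assume x: "x \<in> supported I V (J \<union> J')"
  have G: "abelian_monoid (V i)" if "i \<in> I" for i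
    using V[OF that] by (intro abelian_group.axioms(1) Module.module.axioms)
  note V_simps = abelian_monoid.l_zero[OF G] abelian_monoid.r_zero[OF G] abelian_monoid.zero_closed[OF G]
  \<comment> \<open>\<open>J\<close> and \<open>J'\<close> may overlap here; components at common
    indices go to \<open>y\<close>.\<close>
  define y where "y = (\<lambda>i\<in>I. if i \<in> J then x i else \<zero>\<^bsub>V i\<^esub>)"
  define z where "z = (\<lambda>i\<in>I. if i \<in> J then \<zero>\<^bsub>V i\<^esub> else x i)"
  have fx: "finite {i \<in> I. x i \<noteq> \<zero>\<^bsub>V i\<^esub>}" using x by (simp add: supported_def)
  have "{i \<in> I. y i \<noteq> \<zero>\<^bsub>V i\<^esub>} \<subseteq> {i \<in> I. x i \<noteq> \<zero>\<^bsub>V i\<^esub>}"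
    "{i \<in> I. z i \<noteq> \<zero>\<^bsub>V i\<^esub>} \<subseteq> {i \<in> I. x i \<noteq> \<zero>\<^bsub>V i\<^esub>}"
    by (auto simp: y_def z_def)
  note this[THEN finite_subset, OF fx]
  then have "y \<in> supported I V J" "z \<in> supported I V J'"
    using x by (auto simp: supported_def y_def z_def PiE_iff V_simps)
  moreover have "x = y \<oplus>\<^bsub>dsum_space I V\<^esub> z"
    using x by (auto simp: supported_def y_def z_def PiE_iff V_simps fun_eq_iff extensional_def)
  ultimately show "x \<in> supported I V J <+>\<^bsub>dsum_space I V\<^esub> supported I V J'"
    unfolding set_add_def' by blast
next
  fix x assume "x \<in> supported I V J <+>\<^bsub>dsum_space I V\<^esub> supported I V J'"
  then obtain y z where yz: "y \<in> supported I V J" "z \<in> supported I V J'" "x = y \<oplus>\<^bsub>dsum_space I V\<^esub> z"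
    unfolding set_add_def' by blast
  then have "y \<in> supported I V (J \<union> J')" "z \<in> supported I V (J \<union> J')"
    unfolding supported_def by blast+
  then show "x \<in> supported I V (J \<union> J')"
    unfolding yz(3) by (intro submodule.m_closed[OF supported_submodule[OF assms]])
qed

lemma module_hom_set_add:
  assumes "h \<in> module_hom R V W" "A \<subseteq> carrier V" "B \<subseteq> carrier V"
  shows "h ` (A <+>\<^bsub>V\<^esub> B) = h ` A <+>\<^bsub>W\<^esub> h ` B"
proof -
  have "h ` (A <+>\<^bsub>V\<^esub> B) = (\<Union>a\<in>A. \<Union>b\<in>B. {h (a \<oplus>\<^bsub>V\<^esub> b)})"
    unfolding set_add_def' by blast
  also have "\<dots> = (\<Union>a\<in>A. \<Union>b\<in>B. {h a \<oplus>\<^bsub>W\<^esub> h b})"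
    using module_homD(2)[OF assms(1)] assms(2,3) by (intro SUP_cong) auto
  also have "\<dots> = h ` A <+>\<^bsub>W\<^esub> h ` B"
    unfolding set_add_def' by blast
  finally show ?thesis .
qed

text \<open>Sums of submodules pass through any linear image; intersections pass through this one
  because \<open>h\<close> is injective.\<close>

lemma image_supported_direct_sum:
  assumes R: "cring R" and V: "\<And>i. i \<in> I \<Longrightarrow> module R (V i)" and W: "module R W"
    and h: "h \<in> module_hom R (dsum_space I V) W" and inj: "inj_on h (carrier (dsum_space I V))"
    and disj: "I \<inter> J \<inter> J' = {}"
  shows "h ` supported I V (J \<union> J') = h ` supported I V J <+>\<^bsub>W\<^esub> h ` supported I V J'"
    and "h ` supported I V J \<inter> h ` supported I V J' = {\<zero>\<^bsub>W\<^esub>}"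
proof -
  have sub: "supported I V K \<subseteq> carrier (dsum_space I V)" for K
    by (auto simp: supported_def)
  have Un: "supported I V (J \<union> J') = supported I V J <+>\<^bsub>dsum_space I V\<^esub> supported I V J'"
    by (rule supported_Un[OF R V])
  show "h ` supported I V (J \<union> J') = h ` supported I V J <+>\<^bsub>W\<^esub> h ` supported I V J'"
    unfolding Un by (rule module_hom_set_add[OF h sub sub])
  have Int: "supported I V J \<inter> supported I V J' = {\<zero>\<^bsub>dsum_space I V\<^esub>}"
    by (rule supported_Int[OF R V disj])
  have D: "module R (dsum_space I V)" by (rule dsum_space_module[OF R V])
  show "h ` supported I V J \<inter> h ` supported I V J' = {\<zero>\<^bsub>W\<^esub>}"
    unfolding inj_on_image_Int[OF inj sub sub, symmetric] Int image_insert image_empty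
      module_hom_zero[OF D W h] by (rule refl)
qed

section \<open>Quotients\<close>

text \<open>Closure under negatives comes from multiplication by the scalar -1.\<close>

lemma submodule_abelian_subgroup:
  assumes "submodule R K W"
  shows "abelian_subgroup K W"
proof -
  interpret K: submodule R K W by fact
  interpret W: Module.module R W by (rule K.module)
  have ne: "K \<noteq> {}" using K.zero_closed by blast
  have "\<ominus>\<^bsub>W\<^esub> x \<in> K" if "x \<in> K" for x
    using K.smult_closed[OF W.R.a_inv_closed[OF W.R.one_closed] that] K.subset that
    by (simp only: W.smult_minus_1 subsetD)
  then have "additive_subgroup K W"
    by (intro additive_subgroup.intro W.add.subgroupI) (use K.subset ne in \<open>auto simp: a_inv_def[symmetric]\<close>)
  then show ?thesis by (rule abelian_subgroupI3) (rule W.abelian_group_axioms)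
qed

text \<open>Scalar multiplication in \<open>quot_space\<close> and the arrows of
  \<open>kron_quot\<close> are unions over all representatives of a coset. This evaluates such a
  union at one representative: all the cosets are equal because \<open>g\<close> is additive and
  maps \<open>K\<close> into \<open>K'\<close>.\<close>

lemma coset_lift:
  assumes K: "submodule R K W" and K': "submodule R K' X" and x: "x \<in> carrier W"
    and g: "\<And>y z. y \<in> carrier W \<Longrightarrow> z \<in> carrier W \<Longrightarrow> g (y \<oplus>\<^bsub>W\<^esub> z) = g y \<oplus>\<^bsub>X\<^esub> g z"
    and gc: "\<And>y. y \<in> carrier W \<Longrightarrow> g y \<in> carrier X"
    and gK: "\<And>y. y \<in> K \<Longrightarrow> g y \<in> K'"
  shows "(\<Union>y\<in>K +>\<^bsub>W\<^esub> x. K' +>\<^bsub>X\<^esub> g y) = K' +>\<^bsub>X\<^esub> g x"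
proof -
  interpret K: abelian_subgroup K W by (rule submodule_abelian_subgroup[OF K])
  interpret K': abelian_subgroup K' X by (rule submodule_abelian_subgroup[OF K'])
  have "K' +>\<^bsub>X\<^esub> g y = K' +>\<^bsub>X\<^esub> g x" if y: "y \<in> K +>\<^bsub>W\<^esub> x" for y
  proof -
    obtain k where k: "k \<in> K" "y = k \<oplus>\<^bsub>W\<^esub> x" using y unfolding a_r_coset_def' by blast
    then have "g y = g k \<oplus>\<^bsub>X\<^esub> g x" using g x K.a_subset by auto
    then have "g y \<in> K' +>\<^bsub>X\<^esub> g x" using gK k unfolding a_r_coset_def' by blast
    then show ?thesis
      using abelian_group.a_repr_independence[OF K'.abelian_group_axioms _ gc[OF x] K'.a_subgroup] by metis
  qed
  then show ?thesis using K.a_rcos_self[OF x] by blast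
qed

lemma quot_space_sel [simp]:
  "carrier (quot_space W K) = a_rcosets\<^bsub>W\<^esub> K"
  "X \<oplus>\<^bsub>quot_space W K\<^esub> Y = X <+>\<^bsub>W\<^esub> Y"
  "c \<odot>\<^bsub>quot_space W K\<^esub> X = (\<Union>x\<in>X. K +>\<^bsub>W\<^esub> (c \<odot>\<^bsub>W\<^esub> x))"
  by (simp_all add: quot_space_def)

text \<open>The projection from W to W/K, restricted to a complement P, is injective since a
  difference with zero class lies in P \<inter> K, and onto since P + K is all of W.\<close>

lemma complement_quotient_iso:
  assumes P: "submodule R P W" and K: "submodule R K W"
    and int: "P \<inter> K = {\<zero>\<^bsub>W\<^esub>}" and sum: "P <+>\<^bsub>W\<^esub> K = carrier W"
  shows "(\<lambda>x\<in>P. K +>\<^bsub>W\<^esub> x) \<in> module_hom R (W\<lparr>carrier := P\<rparr>) (quot_space W K)"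
    and "bij_betw (\<lambda>x\<in>P. K +>\<^bsub>W\<^esub> x) P (a_rcosets\<^bsub>W\<^esub> K)"
proof -
  interpret P: submodule R P W by fact
  interpret K: submodule R K W by fact
  interpret W: Module.module R W by (rule K.module)
  interpret Ps: abelian_subgroup P W by (rule submodule_abelian_subgroup[OF P])
  interpret Ks: abelian_subgroup K W by (rule submodule_abelian_subgroup[OF K])
  note Pc = P.subset[THEN subsetD] and Kc = K.subset[THEN subsetD]
  show "(\<lambda>x\<in>P. K +>\<^bsub>W\<^esub> x) \<in> module_hom R (W\<lparr>carrier := P\<rparr>) (quot_space W K)"
  proof (rule module_homI)
    fix c x assume c: "c \<in> carrier R" and x: "x \<in> carrier (W\<lparr>carrier := P\<rparr>)"
    have "(\<Union>y\<in>K +>\<^bsub>W\<^esub> x. K +>\<^bsub>W\<^esub> c \<odot>\<^bsub>W\<^esub> y) = K +>\<^bsub>W\<^esub> c \<odot>\<^bsub>W\<^esub> x"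
      by (rule coset_lift[OF K K]) (use c x Pc in \<open>auto simp: W.smult_r_distr\<close>)
    then show "(\<lambda>x\<in>P. K +>\<^bsub>W\<^esub> x) (c \<odot>\<^bsub>W\<lparr>carrier := P\<rparr>\<^esub> x)
        = c \<odot>\<^bsub>quot_space W K\<^esub> (\<lambda>x\<in>P. K +>\<^bsub>W\<^esub> x) x"
      using c x by simp
  qed (use Pc in \<open>auto intro!: W.a_rcosetsI K.subset simp: Ks.a_rcos_sum\<close>)
  show "bij_betw (\<lambda>x\<in>P. K +>\<^bsub>W\<^esub> x) P (a_rcosets\<^bsub>W\<^esub> K)"
    unfolding bij_betw_def
  proof
    show "inj_on (\<lambda>x\<in>P. K +>\<^bsub>W\<^esub> x) P"
    proof (rule inj_onI)
      fix x y assume x: "x \<in> P" and y: "y \<in> P" and "(\<lambda>x\<in>P. K +>\<^bsub>W\<^esub> x) x = (\<lambda>x\<in>P. K +>\<^bsub>W\<^esub> x) y"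
      then have "x \<in> K +>\<^bsub>W\<^esub> y" using Ks.a_rcos_self[of x] Pc by auto
      then have "x \<ominus>\<^bsub>W\<^esub> y \<in> K" using Ks.a_rcos_module[OF Pc Pc] x y
        by (simp add: a_minus_def)
      moreover have "x \<ominus>\<^bsub>W\<^esub> y \<in> P" using x y by (simp add: a_minus_def)
      ultimately have "x \<ominus>\<^bsub>W\<^esub> y = \<zero>\<^bsub>W\<^esub>" using int by blast
      then show "x = y" using Pc[OF x] Pc[OF y] by simp
    qed
    show "(\<lambda>x\<in>P. K +>\<^bsub>W\<^esub> x) ` P = a_rcosets\<^bsub>W\<^esub> K"
    proof (intro equalityI subsetI)
      fix X assume "X \<in> a_rcosets\<^bsub>W\<^esub> K"
      then obtain w where w: "w \<in> carrier W" "X = K +>\<^bsub>W\<^esub> w" unfolding A_RCOSETS_def' by blast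
      then obtain p k where pk: "p \<in> P" "k \<in> K" "w = p \<oplus>\<^bsub>W\<^esub> k"
        unfolding sum[symmetric] set_add_def' by blast
      \<comment> \<open>Cosets are formed with the element of \<open>K\<close> on the left, hence
        the swap.\<close>
      have "w = k \<oplus>\<^bsub>W\<^esub> p" using pk Pc Kc by (simp add: W.M.a_comm)
      then have "w \<in> K +>\<^bsub>W\<^esub> p" using pk unfolding a_r_coset_def' by blast
      then have "X = K +>\<^bsub>W\<^esub> p"
        using W.M.a_repr_independence[OF _ Pc[OF pk(1)] Ks.a_subgroup] w by metis
      then show "X \<in> (\<lambda>x\<in>P. K +>\<^bsub>W\<^esub> x) ` P" using pk by auto
    qed (use Pc in \<open>auto intro!: W.a_rcosetsI K.subset\<close>)
  qed
qed

section \<open>Kronecker modules\<close>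

lemma kron_homI:
  assumes "f1 \<in> module_hom class_ring (space1 M) (space1 N)" "f1 \<in> extensional (carrier (space1 M))"
    and "f2 \<in> module_hom class_ring (space2 M) (space2 N)" "f2 \<in> extensional (carrier (space2 M))"
    and "\<And>x. x \<in> carrier (space1 M) \<Longrightarrow> f2 (alpha M x) = alpha N (f1 x)"
    and "\<And>x. x \<in> carrier (space1 M) \<Longrightarrow> f2 (beta M x) = beta N (f1 x)"
  shows "(f1, f2) \<in> kron_hom M N"
  using assms unfolding kron_hom_def by auto

lemma kron_homD:
  assumes "f \<in> kron_hom M N"
  shows "fst f \<in> module_hom class_ring (space1 M) (space1 N)"
    and "fst f \<in> extensional (carrier (space1 M))"
    and "snd f \<in> module_hom class_ring (space2 M) (space2 N)"
    and "snd f \<in> extensional (carrier (space2 M))"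
    and "\<And>x. x \<in> carrier (space1 M) \<Longrightarrow> snd f (alpha M x) = alpha N (fst f x)"
    and "\<And>x. x \<in> carrier (space1 M) \<Longrightarrow> snd f (beta M x) = beta N (fst f x)"
  using assms unfolding kron_hom_def by auto

lemma kron_moduleD:
  assumes "kron_module M"
  shows "module class_ring (space1 M)" "module class_ring (space2 M)"
    and "alpha M \<in> module_hom class_ring (space1 M) (space2 M)"
    and "beta M \<in> module_hom class_ring (space1 M) (space2 M)"
    and "\<And>x. x \<in> carrier (space1 M) \<Longrightarrow> alpha M x \<in> carrier (space2 M)"
    and "\<And>x. x \<in> carrier (space1 M) \<Longrightarrow> beta M x \<in> carrier (space2 M)"
  using assms unfolding kron_module_def vectorspace_def LinearCombinations.module_hom_def by auto

lemma kron_moduleI: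
  assumes "module class_ring (space1 M)" "module class_ring (space2 M)"
    and "alpha M \<in> module_hom class_ring (space1 M) (space2 M)"
    and "beta M \<in> module_hom class_ring (space1 M) (space2 M)"
  shows "kron_module M"
  using assms unfolding kron_module_def by (auto intro!: vectorspace.intro class_field)

lemma kron_hom_comp:
  assumes "kron_module L" "f \<in> kron_hom L M" "g \<in> kron_hom M N"
  shows "(\<lambda>x\<in>carrier (space1 L). fst g (fst f x), \<lambda>y\<in>carrier (space2 L). snd g (snd f y)) \<in> kron_hom L N"
  using kron_moduleD[OF assms(1)] kron_homD[OF assms(2)] kron_homD[OF assms(3)]
  by (intro kron_homI module_hom_restrict_comp restrict_extensional) (auto simp: module_homD(1))

text \<open>Compatibility with the arrows follows from injectivity of \<open>snd F\<close>: for x in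
  \<open>space1 N\<close>, the element \<open>alpha M (?k1 x)\<close> is sent by
  \<open>snd F\<close> to \<open>alpha N x\<close>, so it must be the chosen preimage
  \<open>?k2 (alpha N x)\<close>; likewise for \<open>beta\<close>.\<close>

lemma kron_hom_inverse:
  assumes M: "kron_module M" and N: "kron_module N" and F: "F \<in> kron_iso M N"
  shows "(\<lambda>x\<in>carrier (space1 N). inv_into (carrier (space1 M)) (fst F) x,
          \<lambda>y\<in>carrier (space2 N). inv_into (carrier (space2 M)) (snd F) y) \<in> kron_hom N M"
proof -
  let ?k1 = "inv_into (carrier (space1 M)) (fst F)" and ?k2 = "inv_into (carrier (space2 M)) (snd F)"
  have bij: "bij_betw (fst F) (carrier (space1 M)) (carrier (space1 N))"
    "bij_betw (snd F) (carrier (space2 M)) (carrier (space2 N))"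
    and "F \<in> kron_hom M N" using F by (auto simp: kron_iso_def)
  note F = kron_homD[OF this(3)]
  note M = kron_moduleD[OF M] and N = kron_moduleD[OF N]
  have k1: "?k1 x \<in> carrier (space1 M)" "fst F (?k1 x) = x" if "x \<in> carrier (space1 N)" for x
    using bij_betw_inv_into_right[OF bij(1) that] that bij_betw_imp_surj_on[OF bij(1)]
    by (auto intro: inv_into_into)
  have k2: "?k2 y = z" if "z \<in> carrier (space2 M)" "snd F z = y" for y z
    using inv_into_f_eq[OF bij_betw_imp_inj_on[OF bij(2)] that] .
  show ?thesis
    using k1 M N F
    by (intro kron_homI module_hom_restrict module_hom_inv_into bij restrict_extensional) (auto intro!: k2)
qed

lemma kron_dsum_sel [simp]:
  "space1 (kron_dsum I N) = dsum_space I (\<lambda>i. space1 (N i))"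
  "space2 (kron_dsum I N) = dsum_space I (\<lambda>i. space2 (N i))"
  "alpha (kron_dsum I N) x = (\<lambda>i\<in>I. alpha (N i) (x i))"
  "beta (kron_dsum I N) x = (\<lambda>i\<in>I. beta (N i) (x i))"
  by (simp_all add: kron_dsum_def)

text \<open>Linear maps send zero to zero, so a componentwise map neither enlarges the support nor
  leaves \<open>J\<close>.\<close>

lemma supported_map:
  assumes V: "\<And>i. i \<in> I \<Longrightarrow> module R (V i)" and W: "\<And>i. i \<in> I \<Longrightarrow> module R (W i)"
    and h: "\<And>i. i \<in> I \<Longrightarrow> h i \<in> module_hom R (V i) (W i)"
    and x: "x \<in> supported I V J"
  shows "(\<lambda>i\<in>I. h i (x i)) \<in> supported I W J"
proof -
  have h0: "h i \<zero>\<^bsub>V i\<^esub> = \<zero>\<^bsub>W i\<^esub>" if "i \<in> I" for i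
    using module_hom_zero[OF V W h] that by blast
  have fx: "finite {i \<in> I. x i \<noteq> \<zero>\<^bsub>V i\<^esub>}" using x by (simp add: supported_def)
  have "finite {i \<in> I. h i (x i) \<noteq> \<zero>\<^bsub>W i\<^esub>}"
    by (rule finite_subset[OF _ fx]) (use h0 in auto)
  then show ?thesis
    using x h0 module_homD(1)[OF h] by (auto simp: supported_def PiE_iff cong: conj_cong)
qed

text \<open>Preimages are chosen component by component. Surjectivity is asked only on
  \<open>J\<close>, since outside \<open>J\<close> the components of \<open>y\<close> are zero and
  are lifted to zero.\<close>

lemma supported_surj:
  assumes V: "\<And>i. i \<in> I \<Longrightarrow> module R (V i)" and W: "\<And>i. i \<in> I \<Longrightarrow> module R (W i)"
    and h: "\<And>i. i \<in> I \<Longrightarrow> h i \<in> module_hom R (V i) (W i)"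
    and surj: "\<And>i. i \<in> I \<inter> J \<Longrightarrow> carrier (W i) \<subseteq> h i ` carrier (V i)"
    and y: "y \<in> supported I W J"
  shows "\<exists>x\<in>supported I V J. y = (\<lambda>i\<in>I. h i (x i))"
proof -
  have h0: "h i \<zero>\<^bsub>V i\<^esub> = \<zero>\<^bsub>W i\<^esub>" if "i \<in> I" for i
    using module_hom_zero[OF V W h] that by blast
  have V0: "\<zero>\<^bsub>V i\<^esub> \<in> carrier (V i)" if "i \<in> I" for i
    using abelian_monoid.zero_closed abelian_group.axioms(1) Module.module.axioms(2)[OF V[OF that]] by metis
  \<comment> \<open>The extra demand that zero be lifted to zero keeps the family of preimages
    finitely supported and concentrated on \<open>J\<close>.\<close>
  have "\<exists>v\<in>carrier (V i). y i = h i v \<and> (y i = \<zero>\<^bsub>W i\<^esub> \<longrightarrow> v = \<zero>\<^bsub>V i\<^esub>)" if i: "i \<in> I" for i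
  proof (cases "y i = \<zero>\<^bsub>W i\<^esub>")
    case True
    then show ?thesis using h0[OF i] V0[OF i] by auto
  next
    case False
    then have "i \<in> J" "y i \<in> carrier (W i)" using y i unfolding supported_def by auto
    then show ?thesis using surj[of i] i False by auto
  qed
  then obtain v where v: "\<And>i. i \<in> I \<Longrightarrow> v i \<in> carrier (V i)" "\<And>i. i \<in> I \<Longrightarrow> y i = h i (v i)"
    "\<And>i. i \<in> I \<Longrightarrow> y i = \<zero>\<^bsub>W i\<^esub> \<Longrightarrow> v i = \<zero>\<^bsub>V i\<^esub>"
    by metis
  have fy: "finite {i \<in> I. y i \<noteq> \<zero>\<^bsub>W i\<^esub>}" using y by (simp add: supported_def)
  have "finite {i \<in> I. v i \<noteq> \<zero>\<^bsub>V i\<^esub>}"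
    by (rule finite_subset[OF _ fy]) (use v(3) in auto)
  then have "restrict v I \<in> supported I V J"
    using v(1,3) y unfolding supported_def by (auto cong: conj_cong)
  moreover have "y = (\<lambda>i\<in>I. h i (restrict v I i))"
    using y v(2) unfolding supported_def by (auto simp: PiE_iff extensional_def)
  ultimately show ?thesis by blast
qed

lemma kron_dsum_module:
  fixes N :: "'i \<Rightarrow> ('a::field, 'u, 'v) kronecker"
  assumes N: "\<And>i. i \<in> I \<Longrightarrow> kron_module (N i)"
  shows "kron_module (kron_dsum I N)"
proof (rule kron_moduleI)
  note N = kron_moduleD[OF N]
  have R: "cring (class_ring :: 'a ring)" ..
  show "module class_ring (space1 (kron_dsum I N))" "module class_ring (space2 (kron_dsum I N))"
    using N R by (auto intro!: dsum_space_module)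
  have hom: "(\<lambda>x. \<lambda>i\<in>I. h i (x i)) \<in> module_hom class_ring (space1 (kron_dsum I N)) (space2 (kron_dsum I N))"
    if h: "\<And>i. i \<in> I \<Longrightarrow> h i \<in> module_hom class_ring (space1 (N i)) (space2 (N i))" for h
  proof (rule module_homI)
    show "(\<lambda>i\<in>I. h i (x i)) \<in> carrier (space2 (kron_dsum I N))"
      if "x \<in> carrier (space1 (kron_dsum I N))" for x
      using supported_map[OF N(1) N(2) h, where x = x and J = UNIV] that by (simp only: supported_UNIV kron_dsum_sel)
  qed (auto simp: module_homD[OF h] PiE_iff)
  have eq: "alpha (kron_dsum I N) = (\<lambda>x. \<lambda>i\<in>I. alpha (N i) (x i))"
    "beta (kron_dsum I N) = (\<lambda>x. \<lambda>i\<in>I. beta (N i) (x i))" by (auto simp: fun_eq_iff)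
  show "alpha (kron_dsum I N) \<in> module_hom class_ring (space1 (kron_dsum I N)) (space2 (kron_dsum I N))"
    "beta (kron_dsum I N) \<in> module_hom class_ring (space1 (kron_dsum I N)) (space2 (kron_dsum I N))"
    unfolding eq by (intro hom N(3,4); assumption)+
qed

lemma kron_hom_proj:
  assumes N: "\<And>i. i \<in> I \<Longrightarrow> kron_module (N i)" and i: "i \<in> I"
  shows "(\<lambda>x\<in>carrier (space1 (kron_dsum I N)). x i, \<lambda>y\<in>carrier (space2 (kron_dsum I N)). y i)
    \<in> kron_hom (kron_dsum I N) (N i)"
proof -
  have "kron_module (kron_dsum I N)" by (rule kron_dsum_module[OF N])
  note D = kron_moduleD[OF this]
  have "(\<lambda>x. x i) \<in> module_hom class_ring (space1 (kron_dsum I N)) (space1 (N i))"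
    "(\<lambda>x. x i) \<in> module_hom class_ring (space2 (kron_dsum I N)) (space2 (N i))"
    by (rule module_homI; use i in \<open>auto simp: PiE_iff\<close>)+
  then show ?thesis
    by (intro kron_homI module_hom_restrict D restrict_extensional; use D(5,6) i in \<open>simp del: dsum_space_sel(1)\<close>)
qed

section \<open>The space of homomorphisms\<close>

lemma module_hom_pointwise:
  assumes V: "module R V" and W: "module R W"
  shows "(\<lambda>x\<in>carrier V. \<zero>\<^bsub>W\<^esub>) \<in> module_hom R V W"
    and "f \<in> module_hom R V W \<Longrightarrow> g \<in> module_hom R V W \<Longrightarrow>
      (\<lambda>x\<in>carrier V. f x \<oplus>\<^bsub>W\<^esub> g x) \<in> module_hom R V W"
    and "c \<in> carrier R \<Longrightarrow> f \<in> module_hom R V W \<Longrightarrow> (\<lambda>x\<in>carrier V. c \<odot>\<^bsub>W\<^esub> f x) \<in> module_hom R V W"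
proof -
  interpret V: Module.module R V by fact
  interpret W: Module.module R W by fact
  show "(\<lambda>x\<in>carrier V. \<zero>\<^bsub>W\<^esub>) \<in> module_hom R V W"
    by (rule module_homI) auto
  show "(\<lambda>x\<in>carrier V. f x \<oplus>\<^bsub>W\<^esub> g x) \<in> module_hom R V W"
    if f: "f \<in> module_hom R V W" and g: "g \<in> module_hom R V W"
    by (rule module_homI) (simp_all add: module_homD[OF f] module_homD[OF g] W.smult_r_distr W.M.a_ac)
  show "(\<lambda>x\<in>carrier V. c \<odot>\<^bsub>W\<^esub> f x) \<in> module_hom R V W"
    if c: "c \<in> carrier R" and f: "f \<in> module_hom R V W"
  proof (rule module_homI)
    fix e x assume "e \<in> carrier R" "x \<in> carrier V"
    then show "(\<lambda>x\<in>carrier V. c \<odot>\<^bsub>W\<^esub> f x) (e \<odot>\<^bsub>V\<^esub> x) = e \<odot>\<^bsub>W\<^esub> (\<lambda>x\<in>carrier V. c \<odot>\<^bsub>W\<^esub> f x) x"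
      using c by (simp add: module_homD[OF f] flip: W.smult_assoc1) (simp add: V.m_comm)
  qed (use c in \<open>simp_all add: module_homD[OF f] W.smult_r_distr\<close>)
qed

lemma kron_hom_space_sel [simp]:
  "carrier (kron_hom_space M N) = kron_hom M N"
  "\<zero>\<^bsub>kron_hom_space M N\<^esub> =
    (\<lambda>x\<in>carrier (space1 M). \<zero>\<^bsub>space1 N\<^esub>, \<lambda>y\<in>carrier (space2 M). \<zero>\<^bsub>space2 N\<^esub>)"
  "f \<oplus>\<^bsub>kron_hom_space M N\<^esub> g =
    (\<lambda>x\<in>carrier (space1 M). fst f x \<oplus>\<^bsub>space1 N\<^esub> fst g x,
     \<lambda>y\<in>carrier (space2 M). snd f y \<oplus>\<^bsub>space2 N\<^esub> snd g y)"
  "c \<odot>\<^bsub>kron_hom_space M N\<^esub> f =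
    (\<lambda>x\<in>carrier (space1 M). c \<odot>\<^bsub>space1 N\<^esub> fst f x,
     \<lambda>y\<in>carrier (space2 M). c \<odot>\<^bsub>space2 N\<^esub> snd f y)"
  by (simp_all add: kron_hom_space_def)

text \<open>Extensionality makes equality of homomorphisms the same as pointwise equality on the two
  carriers (\<open>eqI\<close>), so each law reduces to the same law in \<open>space1 N\<close> and
  \<open>space2 N\<close>. The result gives \<open>span\<close> and \<open>basis\<close> their
  meaning on the Hom space.\<close>

lemma kron_hom_space_module:
  fixes M :: "('a::field, 'u, 'v) kronecker" and N :: "('a, 'w, 'x) kronecker"
  assumes M: "kron_module M" and N: "kron_module N"
  shows "module class_ring (kron_hom_space M N)"
proof -
  note M = kron_moduleD[OF M] and N = kron_moduleD[OF N]
  interpret N1: Module.module class_ring "space1 N" by (rule N)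
  interpret N2: Module.module class_ring "space2 N" by (rule N)
  let ?H = "kron_hom_space M N"
  have zero: "\<zero>\<^bsub>?H\<^esub> \<in> carrier ?H"
    unfolding kron_hom_space_sel
    by (intro kron_homI module_hom_pointwise M N restrict_extensional)
      (simp_all add: M(5,6) module_hom_zero[OF N(1,2,3)] module_hom_zero[OF N(1,2,4)])
  have add: "f \<oplus>\<^bsub>?H\<^esub> g \<in> carrier ?H" if "f \<in> carrier ?H" "g \<in> carrier ?H" for f g
  proof -
    note f = kron_homD[OF that(1)[unfolded kron_hom_space_sel]]
      and g = kron_homD[OF that(2)[unfolded kron_hom_space_sel]]
    show ?thesis
      unfolding kron_hom_space_sel
      by (intro kron_homI module_hom_pointwise M N f g restrict_extensional)
        (simp_all add: M(5,6) f(5,6) g(5,6) module_homD[OF f(1)] module_homD[OF g(1)]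
          module_homD[OF N(3)] module_homD[OF N(4)])
  qed
  have smult: "c \<odot>\<^bsub>?H\<^esub> f \<in> carrier ?H" if "f \<in> carrier ?H" for c f
  proof -
    note f = kron_homD[OF that[unfolded kron_hom_space_sel]]
    show ?thesis
      unfolding kron_hom_space_sel
      by (intro kron_homI module_hom_pointwise M N f restrict_extensional)
        (simp_all add: M(5,6) f(5,6) module_homD[OF f(1)] module_homD[OF N(3)] module_homD[OF N(4)])
  qed
  have eqI: "f = g" if "f \<in> carrier ?H" "g \<in> carrier ?H"
    "\<And>x. x \<in> carrier (space1 M) \<Longrightarrow> fst f x = fst g x" "\<And>y. y \<in> carrier (space2 M) \<Longrightarrow> snd f y = snd g y" for f g
    using kron_homD(2,4)[OF that(1)[unfolded kron_hom_space_sel]]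
      kron_homD(2,4)[OF that(2)[unfolded kron_hom_space_sel]] that(3,4)
    by (auto intro!: prod_eqI extensionalityI)
  have val: "x \<in> carrier (space1 M) \<Longrightarrow> fst f x \<in> carrier (space1 N)"
    "y \<in> carrier (space2 M) \<Longrightarrow> snd f y \<in> carrier (space2 N)" if "f \<in> carrier ?H" for f x y
    by (rule module_homD(1)[OF kron_homD(1)[OF that[unfolded kron_hom_space_sel]]], assumption)
      (rule module_homD(1)[OF kron_homD(3)[OF that[unfolded kron_hom_space_sel]]])
  show ?thesis
  proof (rule moduleI[OF _ abelian_groupI])
    show "cring (class_ring :: 'a ring)" ..
    fix f g h assume f: "f \<in> carrier ?H" and g: "g \<in> carrier ?H" and h: "h \<in> carrier ?H"
    show "f \<oplus>\<^bsub>?H\<^esub> g \<oplus>\<^bsub>?H\<^esub> h = f \<oplus>\<^bsub>?H\<^esub> (g \<oplus>\<^bsub>?H\<^esub> h)"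
      by (intro eqI add f g h) (simp_all add: val[OF f] val[OF g] val[OF h] N1.M.a_assoc N2.M.a_assoc)
  next
    fix f g assume f: "f \<in> carrier ?H" and g: "g \<in> carrier ?H"
    show "f \<oplus>\<^bsub>?H\<^esub> g = g \<oplus>\<^bsub>?H\<^esub> f"
      by (intro eqI add f g) (simp_all add: val[OF f] val[OF g] N1.M.a_comm N2.M.a_comm)
    show "c \<odot>\<^bsub>?H\<^esub> (f \<oplus>\<^bsub>?H\<^esub> g) = c \<odot>\<^bsub>?H\<^esub> f \<oplus>\<^bsub>?H\<^esub> c \<odot>\<^bsub>?H\<^esub> g" for c
      by (intro eqI add smult f g) (simp_all add: val[OF f] val[OF g] N1.smult_r_distr N2.smult_r_distr)
  next
    fix f assume f: "f \<in> carrier ?H"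
    show "\<zero>\<^bsub>?H\<^esub> \<oplus>\<^bsub>?H\<^esub> f = f"
      by (intro eqI add zero f) (simp_all add: val[OF f])
    show "\<exists>g\<in>carrier ?H. g \<oplus>\<^bsub>?H\<^esub> f = \<zero>\<^bsub>?H\<^esub>"
    \<comment> \<open>Taking the multiple by -1 as the additive inverse reuses closure under
      scalars, so compatibility with the arrows need not be checked again.\<close>
    proof (rule bexI[of _ "(-1) \<odot>\<^bsub>?H\<^esub> f"])
      have "(-1) \<odot>\<^bsub>space1 N\<^esub> x = \<ominus>\<^bsub>space1 N\<^esub> x" if "x \<in> carrier (space1 N)" for x
        using N1.smult_minus_1[OF that] by (simp add: class_ring_simps)
      moreover have "(-1) \<odot>\<^bsub>space2 N\<^esub> x = \<ominus>\<^bsub>space2 N\<^esub> x" if "x \<in> carrier (space2 N)" for x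
        using N2.smult_minus_1[OF that] by (simp add: class_ring_simps)
      ultimately show "(-1) \<odot>\<^bsub>?H\<^esub> f \<oplus>\<^bsub>?H\<^esub> f = \<zero>\<^bsub>?H\<^esub>"
        by (intro eqI add smult zero f) (simp_all add: val[OF f] N1.M.l_neg N2.M.l_neg)
    qed (rule smult[OF f])
    show "(c \<oplus>\<^bsub>class_ring\<^esub> e) \<odot>\<^bsub>?H\<^esub> f = c \<odot>\<^bsub>?H\<^esub> f \<oplus>\<^bsub>?H\<^esub> e \<odot>\<^bsub>?H\<^esub> f" for c e
      using N1.smult_l_distr[of c e] N2.smult_l_distr[of c e]
      by (intro eqI add smult f) (simp_all add: val[OF f])
    show "(c \<otimes>\<^bsub>class_ring\<^esub> e) \<odot>\<^bsub>?H\<^esub> f = c \<odot>\<^bsub>?H\<^esub> (e \<odot>\<^bsub>?H\<^esub> f)" for c e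
      using N1.smult_assoc1[of c e] N2.smult_assoc1[of c e]
      by (intro eqI smult f) (simp_all add: val[OF f])
    show "\<one>\<^bsub>class_ring\<^esub> \<odot>\<^bsub>?H\<^esub> f = f"
      using N1.smult_one N2.smult_one
      by (intro eqI smult f) (simp_all add: val[OF f])
  qed (assumption | rule zero add smult)+
qed

text \<open>For a fixed point, the homomorphisms that vanish there form a submodule of the Hom
  space; if it contains the basis, it contains the span, which is everything. For an empty basis the
  Hom space is zero and both sides are all of M.\<close>

lemma kron_Inter_ker_basis:
  fixes M :: "('a::field, 'u, 'v) kronecker" and N :: "('a, 'w, 'x) kronecker"
  assumes M: "kron_module M" and N: "kron_module N"
    and basis: "vectorspace.basis class_ring (kron_hom_space M N) (f ` A)"
  shows "kron_Inter M A (\<lambda>i. kron_ker M N (f i)) =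
    ({x \<in> carrier (space1 M). \<forall>g\<in>kron_hom M N. fst g x = \<zero>\<^bsub>space1 N\<^esub>},
     {y \<in> carrier (space2 M). \<forall>g\<in>kron_hom M N. snd g y = \<zero>\<^bsub>space2 N\<^esub>})"
proof -
  let ?H = "kron_hom_space M N"
  interpret N1: Module.module class_ring "space1 N" by (rule kron_moduleD[OF N])
  interpret N2: Module.module class_ring "space2 N" by (rule kron_moduleD[OF N])
  interpret H: vectorspace class_ring ?H
    by (intro vectorspace.intro class_field kron_hom_space_module M N)
  have B: "f ` A \<subseteq> carrier ?H" and span: "H.span (f ` A) = carrier ?H"
    using basis unfolding H.basis_def by auto
  have sub1: "submodule class_ring {g \<in> carrier ?H. fst g x = \<zero>\<^bsub>space1 N\<^esub>} ?H"
    if x: "x \<in> carrier (space1 M)" for x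
  proof (rule submodule.intro[OF H.module_axioms])
    show "f \<oplus>\<^bsub>?H\<^esub> g \<in> {g \<in> carrier ?H. fst g x = \<zero>\<^bsub>space1 N\<^esub>}"
      if "f \<in> {g \<in> carrier ?H. fst g x = \<zero>\<^bsub>space1 N\<^esub>}"
        "g \<in> {g \<in> carrier ?H. fst g x = \<zero>\<^bsub>space1 N\<^esub>}" for f g
      using that x H.M.a_closed[of f g] by simp
    show "c \<odot>\<^bsub>?H\<^esub> f \<in> {g \<in> carrier ?H. fst g x = \<zero>\<^bsub>space1 N\<^esub>}"
      if "f \<in> {g \<in> carrier ?H. fst g x = \<zero>\<^bsub>space1 N\<^esub>}" for c f
      using that x H.smult_closed[of c f] by simp
  qed (use x H.M.zero_closed in auto)
  have sub2: "submodule class_ring {g \<in> carrier ?H. snd g y = \<zero>\<^bsub>space2 N\<^esub>} ?H"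
    if y: "y \<in> carrier (space2 M)" for y
  proof (rule submodule.intro[OF H.module_axioms])
    show "f \<oplus>\<^bsub>?H\<^esub> g \<in> {g \<in> carrier ?H. snd g y = \<zero>\<^bsub>space2 N\<^esub>}"
      if "f \<in> {g \<in> carrier ?H. snd g y = \<zero>\<^bsub>space2 N\<^esub>}"
        "g \<in> {g \<in> carrier ?H. snd g y = \<zero>\<^bsub>space2 N\<^esub>}" for f g
      using that y H.M.a_closed[of f g] by simp
    show "c \<odot>\<^bsub>?H\<^esub> f \<in> {g \<in> carrier ?H. snd g y = \<zero>\<^bsub>space2 N\<^esub>}"
      if "f \<in> {g \<in> carrier ?H. snd g y = \<zero>\<^bsub>space2 N\<^esub>}" for c f
      using that y H.smult_closed[of c f] by simp
  qed (use y H.M.zero_closed in auto)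
  have 1: "(\<forall>i\<in>A. fst (f i) x = \<zero>\<^bsub>space1 N\<^esub>) \<longleftrightarrow> (\<forall>g\<in>carrier ?H. fst g x = \<zero>\<^bsub>space1 N\<^esub>)"
    if x: "x \<in> carrier (space1 M)" for x
    using H.span_is_subset[OF _ sub1[OF x], of "f ` A"] B unfolding span by blast
  have 2: "(\<forall>i\<in>A. snd (f i) y = \<zero>\<^bsub>space2 N\<^esub>) \<longleftrightarrow> (\<forall>g\<in>carrier ?H. snd g y = \<zero>\<^bsub>space2 N\<^esub>)"
    if y: "y \<in> carrier (space2 M)" for y
    using H.span_is_subset[OF _ sub2[OF y], of "f ` A"] B unfolding span by blast
  have "carrier (space1 M) \<inter> (\<Inter>i\<in>A. a_kernel (space1 M) (space1 N) (fst (f i)))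
      = {x \<in> carrier (space1 M). \<forall>i\<in>A. fst (f i) x = \<zero>\<^bsub>space1 N\<^esub>}"
    "carrier (space2 M) \<inter> (\<Inter>i\<in>A. a_kernel (space2 M) (space2 N) (snd (f i)))
      = {y \<in> carrier (space2 M). \<forall>i\<in>A. snd (f i) y = \<zero>\<^bsub>space2 N\<^esub>}"
    unfolding a_kernel_def' by blast+
  then show ?thesis
    unfolding kron_Inter_def kron_ker_def fst_conv snd_conv
    by (simp only: 1 2 kron_hom_space_sel(1) cong: conj_cong)
qed

section \<open>Homomorphisms into preprojective modules\<close>

lemma mat_kron_sel [simp]:
  fixes L :: "'a::field mat \<times> 'a mat"
  shows "space1 (mat_kron L) = module_vec TYPE('a) (dim_col (fst L))"
    and "space2 (mat_kron L) = module_vec TYPE('a) (dim_row (fst L))"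
    and "alpha (mat_kron L) = (*\<^sub>v) (fst L)"
    and "beta (mat_kron L) = (*\<^sub>v) (snd L)"
  by (simp_all add: mat_kron_def)

lemma module_vec_module: "module class_ring (module_vec TYPE('a::field) n)"
  using vec_vs[where 'a='a, of n] unfolding vectorspace_def by blast

lemma mat_kron_module:
  fixes A B :: "'a::field mat"
  assumes "A \<in> carrier_mat m n" "B \<in> carrier_mat m n"
  shows "kron_module (mat_kron (A, B))"
proof (rule kron_moduleI)
  have hom: "(*\<^sub>v) C \<in> module_hom class_ring (module_vec TYPE('a) n) (module_vec TYPE('a) m)"
    if "C \<in> carrier_mat m n" for C :: "'a mat"
    by (rule module_homI) (use that in \<open>auto simp: module_vec_def mult_add_distrib_mat_vec mult_mat_vec\<close>)
  show "alpha (mat_kron (A, B)) \<in> module_hom class_ring (space1 (mat_kron (A, B))) (space2 (mat_kron (A, B)))"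
    "beta (mat_kron (A, B)) \<in> module_hom class_ring (space1 (mat_kron (A, B))) (space2 (mat_kron (A, B)))"
    using assms hom by auto
qed (auto intro: module_vec_module)

lemma preproj_carrier: "fst (preproj n) \<in> carrier_mat n (n - 1)" "snd (preproj n) \<in> carrier_mat n (n - 1)"
  by (simp_all add: preproj_def)

lemma preproj_kron_module: "kron_module (mat_kron (preproj n))"
  using mat_kron_module[OF preproj_carrier] by simp

lemma indecomposable_kron_module:
  fixes L :: "'a::field mat \<times> 'a mat"
  assumes "L \<in> indecomposables"
  shows "kron_module (mat_kron L)"
  using assms
  by (auto simp: indecomposables_def preprojectives_def regulars_def preinjectives_def preproj_kron_module
      regular_def regular_inf_def preinj_def intro: mat_kron_module)

text \<open>In coordinates, \<open>alpha\<close> of P_m appends a zero at the end and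
  \<open>beta\<close> puts a zero in front; everything below about P_m rests on these two
  formulas.\<close>

lemma preproj_index:
  fixes v :: "'a::field vec"
  assumes v: "v \<in> carrier_vec (m - 1)" and i: "i < m"
  shows "(fst (preproj m) *\<^sub>v v) $ i = (if i < m - 1 then v $ i else 0)"
    and "(snd (preproj m) *\<^sub>v v) $ i = (if i = 0 then 0 else v $ (i - 1))"
proof -
  have "(fst (preproj m) *\<^sub>v v) $ i = (\<Sum>j\<in>{0..<m - 1}. (if i = j then 1 else 0) * v $ j)"
    using v i by (simp add: preproj_def scalar_prod_def)
  also have "\<dots> = (\<Sum>j\<in>{0..<m - 1}. if i = j then v $ j else 0)"
    by (intro sum.cong) auto
  also have "\<dots> = (if i < m - 1 then v $ i else 0)" by simp
  finally show "(fst (preproj m) *\<^sub>v v) $ i = (if i < m - 1 then v $ i else 0)" .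
  have "(snd (preproj m) *\<^sub>v v) $ i = (\<Sum>j\<in>{0..<m - 1}. (if i = Suc j then 1 else 0) * v $ j)"
    using v i by (simp add: preproj_def scalar_prod_def)
  also have "\<dots> = (\<Sum>j\<in>{0..<m - 1}. if i = Suc j then v $ j else 0)"
    by (intro sum.cong) auto
  \<comment> \<open>The condition is solved for j so that the sum collapses to one term. Since 0 - 1
    = 0 for naturals, the case i = 0 would pick up a spurious j = 0; the inner conditional removes
    it.\<close>
  also have "\<dots> = (\<Sum>j\<in>{0..<m - 1}. if i - 1 = j then (if i = 0 then 0 else v $ j) else 0)"
    by (intro sum.cong) auto
  also have "\<dots> = (if i = 0 then 0 else v $ (i - 1))" using i by (cases i) auto
  finally show "(snd (preproj m) *\<^sub>v v) $ i = (if i = 0 then 0 else v $ (i - 1))" .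
qed

text \<open>If \<open>a\<close> is onto, then the last coordinate of \<open>g2\<close> vanishes, because \<open>preproj m\<close> maps into
  the first \<open>m - 1\<close> coordinates by \<open>alpha\<close>; and since \<open>g2 (b x)\<close> is \<open>g2 (a x)\<close> shifted by one,
  the vanishing propagates to all other coordinates. The case of \<open>b\<close> is the mirror image.\<close>

lemma hom_to_preproj_eq_zero:
  fixes g1 :: "'x \<Rightarrow> 'a::field vec"
  assumes g1: "\<And>x. x \<in> X \<Longrightarrow> g1 x \<in> carrier_vec (m - 1)"
    and g2: "\<And>y. y \<in> Y \<Longrightarrow> g2 y \<in> carrier_vec m"
    and aY: "\<And>x. x \<in> X \<Longrightarrow> a x \<in> Y" and bY: "\<And>x. x \<in> X \<Longrightarrow> b x \<in> Y"
    and ga: "\<And>x. x \<in> X \<Longrightarrow> g2 (a x) = fst (preproj m) *\<^sub>v g1 x"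
    and gb: "\<And>x. x \<in> X \<Longrightarrow> g2 (b x) = snd (preproj m) *\<^sub>v g1 x"
    and surj: "Y \<subseteq> a ` X \<or> Y \<subseteq> b ` X"
  shows "\<forall>x\<in>X. g1 x = 0\<^sub>v (m - 1)" and "\<forall>y\<in>Y. g2 y = 0\<^sub>v m"
proof -
  have a: "g2 (a x) $ i = (if i < m - 1 then g1 x $ i else 0)" if "x \<in> X" "i < m" for x i
    using preproj_index(1)[OF g1] that ga by simp
  have b: "g2 (b x) $ i = (if i = 0 then 0 else g1 x $ (i - 1))" if "x \<in> X" "i < m" for x i
    using preproj_index(2)[OF g1] that gb by simp
  have *: "g2 y $ i = 0" if "y \<in> Y" "i < m" for y i
    using surj
  proof
    assume surj: "Y \<subseteq> a ` X"
    have "\<forall>y\<in>Y. g2 y $ (m - 1 - k) = 0" if "k < m" for k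
      using that
    proof (induction k)
      case 0
      then show ?case using surj a by auto
    next
      case (Suc k)
      show ?case
      proof
        fix y assume "y \<in> Y"
        then obtain x where x: "x \<in> X" "y = a x" using surj by blast
        have "g2 (b x) $ (m - 1 - k) = 0" using Suc bY[OF x(1)] by simp
        then have "g1 x $ (m - 1 - Suc k) = 0" using b[OF x(1), of "m - 1 - k"] Suc.prems by simp
        then show "g2 y $ (m - 1 - Suc k) = 0" using a[OF x(1), of "m - 1 - Suc k"] x Suc.prems by simp
      qed
    qed
    from this[of "m - 1 - i"] that show ?thesis by auto
  next
    assume surj: "Y \<subseteq> b ` X"
    have "\<forall>y\<in>Y. g2 y $ k = 0" if "k < m" for k
      using that
    proof (induction k)
      case 0
      then show ?case using surj b by auto
    next
      case (Suc k)
      show ?case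
      proof
        fix y assume "y \<in> Y"
        then obtain x where x: "x \<in> X" "y = b x" using surj by blast
        have "g2 (a x) $ k = 0" using Suc aY[OF x(1)] by simp
        then have "g1 x $ k = 0" using a[OF x(1), of k] Suc.prems by (simp split: if_splits)
        then show "g2 y $ Suc k = 0" using b[OF x(1), of "Suc k"] x Suc.prems by simp
      qed
    qed
    with that show ?thesis by blast
  qed
  show "\<forall>y\<in>Y. g2 y = 0\<^sub>v m" using * g2 by (auto intro!: eq_vecI)
  \<comment> \<open>\<open>alpha\<close> of P_m is injective: the entries of \<open>g1 x\<close> are
    the first m - 1 entries of \<open>g2 (a x)\<close>.\<close>
  have "g1 x $ i = 0" if "x \<in> X" "i < m - 1" for x i
    using a[OF that(1), of i] *[OF aY[OF that(1)], of i] that by simp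
  then show "\<forall>x\<in>X. g1 x = 0\<^sub>v (m - 1)" using g1 by (auto intro!: eq_vecI)
qed

text \<open>The length of \<open>v\<close> is read off from \<open>v\<close>, so one function serves
  both vertices. A vector longer than m would be truncated; this is still linear, but injectivity
  and compatibility with the arrows use that the length grows.\<close>

definition pad_vec :: "nat \<Rightarrow> 'a::zero vec \<Rightarrow> 'a vec" where
  "pad_vec m v = vec m (\<lambda>i. if i < dim_vec v then v $ i else 0)"

lemma pad_vec_simps [simp]:
  "pad_vec m v \<in> carrier_vec m" "dim_vec (pad_vec m v) = m"
  "i < m \<Longrightarrow> pad_vec m v $ i = (if i < dim_vec v then v $ i else 0)"
  by (simp_all add: pad_vec_def)

lemma pad_vec_eq_zero:
  assumes "v \<in> carrier_vec n" "n \<le> m" "pad_vec m v = 0\<^sub>v m"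
  shows "v = 0\<^sub>v n"
proof (rule eq_vecI)
  fix i assume "i < dim_vec (0\<^sub>v n)"
  then show "v $ i = 0\<^sub>v n $ i"
    using arg_cong[OF assms(3), of "\<lambda>w. w $ i"] assms(1,2) by auto
qed (use assms(1) in auto)

text \<open>Zeros added at the end do not interfere with a zero appended by \<open>alpha\<close> or
  put in front by \<open>beta\<close>. Because of n \<le> m nothing is cut off; truncation would
  fail to commute with \<open>alpha\<close> in the last coordinate.\<close>

lemma pad_vec_kron_hom:
  assumes "n \<le> m"
  shows "(\<lambda>v\<in>carrier (space1 (mat_kron (preproj n))). pad_vec (m - 1) v,
          \<lambda>v\<in>carrier (space2 (mat_kron (preproj n))). pad_vec m v)
    \<in> kron_hom (mat_kron (preproj n)) (mat_kron (preproj m :: 'a::field mat \<times> 'a mat))"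
proof -
  have dims: "dim_col (fst (preproj k :: 'a mat \<times> 'a mat)) = k - 1"
    "dim_row (fst (preproj k :: 'a mat \<times> 'a mat)) = k"
    "dim_row (snd (preproj k :: 'a mat \<times> 'a mat)) = k" for k
    by (simp_all add: preproj_def)
  have hom: "pad_vec k' \<in> module_hom class_ring (module_vec TYPE('a) k) (module_vec TYPE('a) k')" for k k'
    by (rule module_homI) (auto simp: module_vec_def)
  have "pad_vec m (fst (preproj n) *\<^sub>v v) = fst (preproj m) *\<^sub>v pad_vec (m - 1) v" (is ?A)
    "pad_vec m (snd (preproj n) *\<^sub>v v) = snd (preproj m) *\<^sub>v pad_vec (m - 1) v" (is ?B)
    if v: "v \<in> carrier_vec (n - 1)" for v :: "'a vec"
  proof -
    have p: "pad_vec (m - 1) v \<in> carrier_vec (m - 1)" by simp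
    show ?A
    proof (rule eq_vecI)
      fix i assume "i < dim_vec (fst (preproj m) *\<^sub>v pad_vec (m - 1) v)"
      then have i: "i < m" by (simp add: dims)
      have pad: "pad_vec m (fst (preproj n) *\<^sub>v v) $ i = (if i < n then (if i < n - 1 then v $ i else 0) else 0)"
        by (simp only: pad_vec_simps(3)[OF i] dim_mult_mat_vec dims preproj_index(1)[OF v] cong: if_cong)
      show "pad_vec m (fst (preproj n) *\<^sub>v v) $ i = (fst (preproj m) *\<^sub>v pad_vec (m - 1) v) $ i"
        unfolding preproj_index(1)[OF p i] pad
        using i assms carrier_vecD[OF v] by simp arith
    qed (simp add: dims)
    show ?B
    proof (rule eq_vecI)
      fix i assume "i < dim_vec (snd (preproj m) *\<^sub>v pad_vec (m - 1) v)"
      then have i: "i < m" by (simp add: dims)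
      have pad: "pad_vec m (snd (preproj n) *\<^sub>v v) $ i = (if i < n then (if i = 0 then 0 else v $ (i - 1)) else 0)"
        by (simp only: pad_vec_simps(3)[OF i] dim_mult_mat_vec dims preproj_index(2)[OF v] cong: if_cong)
      show "pad_vec m (snd (preproj n) *\<^sub>v v) $ i = (snd (preproj m) *\<^sub>v pad_vec (m - 1) v) $ i"
        unfolding preproj_index(2)[OF p i] pad
        using i assms carrier_vecD[OF v] by (cases i) auto
    qed (simp add: dims)
  qed
  note comm = this
  have mem: "fst (preproj n) *\<^sub>v v \<in> carrier_vec n" "snd (preproj n) *\<^sub>v v \<in> carrier_vec n" for v :: "'a vec"
    by (rule carrier_vecI; simp only: dim_mult_mat_vec dims)+
  show ?thesis
  proof (intro kron_homI module_hom_restrict kron_moduleD(1,2)[OF preproj_kron_module] restrict_extensional)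
    show "pad_vec (m - 1) \<in> module_hom class_ring
          (space1 (mat_kron (preproj n))) (space1 (mat_kron (preproj m :: 'a mat \<times> 'a mat)))"
      "pad_vec m \<in> module_hom class_ring
          (space2 (mat_kron (preproj n))) (space2 (mat_kron (preproj m :: 'a mat \<times> 'a mat)))"
      unfolding mat_kron_sel dims by (rule hom)+
  qed (simp_all only: mat_kron_sel dims module_vec_simps restrict_apply' mem comm)
qed

section \<open>Decomposed modules\<close>

text \<open>This is \<open>part_of\<close> for an arbitrary set of indices instead of a set of
  isoclasses. The freedom is needed to cut the nonpreprojective summands according to which arrow is
  onto.\<close>

definition part :: "'i set \<Rightarrow> ('i \<Rightarrow> ('a, 'u, 'v) kronecker) \<Rightarrow> (('i \<Rightarrow> 'u) \<Rightarrow> 'w) \<times> (('i \<Rightarrow> 'v) \<Rightarrow> 'x)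
    \<Rightarrow> 'i set \<Rightarrow> 'w set \<times> 'x set" where
  "part I N F J = (fst F ` supported I (\<lambda>i. space1 (N i)) J, snd F ` supported I (\<lambda>i. space2 (N i)) J)"

locale kron_decomposition =
  fixes I :: "'i set" and N :: "'i \<Rightarrow> ('a::field, 'u, 'v) kronecker"
    and M :: "('a, 'w, 'x) kronecker"
    and F :: "(('i \<Rightarrow> 'u) \<Rightarrow> 'w) \<times> (('i \<Rightarrow> 'v) \<Rightarrow> 'x)"
  assumes N: "\<And>i. i \<in> I \<Longrightarrow> kron_module (N i)"
    and M: "kron_module M"
    and F: "F \<in> kron_iso (kron_dsum I N) M"
begin

abbreviation "V1 i \<equiv> space1 (N i)"
abbreviation "V2 i \<equiv> space2 (N i)"

lemma N1: "i \<in> I \<Longrightarrow> module class_ring (V1 i)" and N2: "i \<in> I \<Longrightarrow> module class_ring (V2 i)"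
  by (rule kron_moduleD[OF N], assumption)+

lemma cring: "cring (class_ring :: 'a ring)" ..

lemma D: "kron_module (kron_dsum I N)"
  by (rule kron_dsum_module[OF N])

lemma F_hom: "F \<in> kron_hom (kron_dsum I N) M"
  using F by (simp add: kron_iso_def)

lemma F1: "fst F \<in> module_hom class_ring (dsum_space I V1) (space1 M)"
  and F2: "snd F \<in> module_hom class_ring (dsum_space I V2) (space2 M)"
  using kron_homD(1,3)[OF F_hom] by simp_all

lemma F_bij: "bij_betw (fst F) (carrier (dsum_space I V1)) (carrier (space1 M))"
  "bij_betw (snd F) (carrier (dsum_space I V2)) (carrier (space2 M))"
  using F by (simp_all add: kron_iso_def del: dsum_space_sel)

lemma F_comm:
  assumes "x \<in> carrier (dsum_space I V1)"
  shows "alpha M (fst F x) = snd F (\<lambda>i\<in>I. alpha (N i) (x i))"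
    and "beta M (fst F x) = snd F (\<lambda>i\<in>I. beta (N i) (x i))"
  using kron_homD(5,6)[OF F_hom] assms by (simp_all del: dsum_space_sel)

lemma supported_subset: "supported I V1 J \<subseteq> carrier (dsum_space I V1)"
  "supported I V2 J \<subseteq> carrier (dsum_space I V2)"
  by (auto simp: supported_def)

lemma part_submodule:
  "submodule class_ring (fst (part I N F J)) (space1 M)"
  "submodule class_ring (snd (part I N F J)) (space2 M)"
  unfolding part_def fst_conv snd_conv
   apply (rule image_submodule[OF _ kron_moduleD(1)[OF M] F1])
    apply (rule dsum_space_module[OF cring N1], assumption)
   apply (rule supported_submodule[OF cring N1], assumption)
  apply (rule image_submodule[OF _ kron_moduleD(2)[OF M] F2])
   apply (rule dsum_space_module[OF cring N2], assumption)
  apply (rule supported_submodule[OF cring N2], assumption)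
  done

lemma part_UNIV: "part I N F UNIV = (carrier (space1 M), carrier (space2 M))"
  using F_bij by (simp add: part_def supported_UNIV bij_betw_def del: dsum_space_sel)

lemma part_cong:
  assumes "I \<inter> J = I \<inter> J'"
  shows "part I N F J = part I N F J'"
  unfolding part_def supported_cong[OF assms] by (rule refl)

lemma part_direct_sum:
  assumes "I \<inter> J \<inter> J' = {}"
  shows "kron_is_direct_sum M (part I N F (J \<union> J')) (part I N F J) (part I N F J')"
proof -
  have "fst F ` supported I V1 (J \<union> J')
      = fst F ` supported I V1 J <+>\<^bsub>space1 M\<^esub> fst F ` supported I V1 J'"
    "fst F ` supported I V1 J \<inter> fst F ` supported I V1 J' = {\<zero>\<^bsub>space1 M\<^esub>}"
    by (rule image_supported_direct_sum[OF cring N1 kron_moduleD(1)[OF M] F1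
          bij_betw_imp_inj_on[OF F_bij(1)] assms], assumption)+
  moreover have "snd F ` supported I V2 (J \<union> J')
      = snd F ` supported I V2 J <+>\<^bsub>space2 M\<^esub> snd F ` supported I V2 J'"
    "snd F ` supported I V2 J \<inter> snd F ` supported I V2 J' = {\<zero>\<^bsub>space2 M\<^esub>}"
    by (rule image_supported_direct_sum[OF cring N2 kron_moduleD(2)[OF M] F2
          bij_betw_imp_inj_on[OF F_bij(2)] assms], assumption)+
  ultimately show ?thesis
    unfolding kron_is_direct_sum_def part_def by simp
qed

text \<open>The arrows of the direct sum act componentwise, so they stay within \<open>J\<close>,
  and \<open>F\<close> commutes with the arrows. This makes each part a submodule of the Kronecker
  module and not just a pair of subspaces.\<close>

lemma part_arrows:
  assumes "x \<in> fst (part I N F J)"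
  shows "alpha M x \<in> snd (part I N F J)" "beta M x \<in> snd (part I N F J)"
proof -
  obtain y where y: "y \<in> supported I V1 J" "x = fst F y"
    using assms unfolding part_def by auto
  then have yc: "y \<in> carrier (dsum_space I V1)" using supported_subset by blast
  have "(\<lambda>i\<in>I. alpha (N i) (y i)) \<in> supported I V2 J"
    by (rule supported_map[OF N1 N2 kron_moduleD(3)[OF N] y(1)])
  moreover have "(\<lambda>i\<in>I. beta (N i) (y i)) \<in> supported I V2 J"
    by (rule supported_map[OF N1 N2 kron_moduleD(4)[OF N] y(1)])
  ultimately show "alpha M x \<in> snd (part I N F J)" "beta M x \<in> snd (part I N F J)"
    unfolding y(2) F_comm[OF yc] part_def by auto
qed

text \<open>\<open>supported_surj\<close> finds the preimage inside the same index set, so the part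
  at vertex 2 is covered by the part at vertex 1 and not merely by \<open>space1 M\<close>.\<close>

lemma part_surj:
  shows "(\<And>i. i \<in> I \<inter> J \<Longrightarrow> carrier (V2 i) \<subseteq> alpha (N i) ` carrier (V1 i)) \<Longrightarrow>
      snd (part I N F J) \<subseteq> alpha M ` fst (part I N F J)"
    and "(\<And>i. i \<in> I \<inter> J \<Longrightarrow> carrier (V2 i) \<subseteq> beta (N i) ` carrier (V1 i)) \<Longrightarrow>
      snd (part I N F J) \<subseteq> beta M ` fst (part I N F J)"
proof -
  have *: "snd (part I N F J) \<subseteq> h' ` fst (part I N F J)"
    if h: "\<And>i. i \<in> I \<Longrightarrow> h i \<in> module_hom class_ring (V1 i) (V2 i)"
      and h': "\<And>x. x \<in> carrier (dsum_space I V1) \<Longrightarrow> h' (fst F x) = snd F (\<lambda>i\<in>I. h i (x i))"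
      and surj: "\<And>i. i \<in> I \<inter> J \<Longrightarrow> carrier (V2 i) \<subseteq> h i ` carrier (V1 i)" for h h'
  proof
    fix z assume "z \<in> snd (part I N F J)"
    then obtain y where y: "y \<in> supported I V2 J" "z = snd F y" unfolding part_def by auto
    have "\<exists>x\<in>supported I V1 J. y = (\<lambda>i\<in>I. h i (x i))"
      by (rule supported_surj[OF N1 N2 h surj y(1)])
    then obtain x where x: "x \<in> supported I V1 J" "y = (\<lambda>i\<in>I. h i (x i))" by blast
    have "x \<in> carrier (dsum_space I V1)" using x(1) supported_subset by blast
    from h'[OF this] have "z = h' (fst F x)" using x(2) y(2) by simp
    then show "z \<in> h' ` fst (part I N F J)" using x(1) unfolding part_def by auto
  qed
  show "snd (part I N F J) \<subseteq> alpha M ` fst (part I N F J)"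
    if "\<And>i. i \<in> I \<inter> J \<Longrightarrow> carrier (V2 i) \<subseteq> alpha (N i) ` carrier (V1 i)"
    by (rule *[of "\<lambda>i. alpha (N i)"]) (use that in \<open>auto intro: kron_moduleD(3)[OF N] F_comm(1) simp del: dsum_space_sel\<close>)
  show "snd (part I N F J) \<subseteq> beta M ` fst (part I N F J)"
    if "\<And>i. i \<in> I \<inter> J \<Longrightarrow> carrier (V2 i) \<subseteq> beta (N i) ` carrier (V1 i)"
    by (rule *[of "\<lambda>i. beta (N i)"]) (use that in \<open>auto intro: kron_moduleD(4)[OF N] F_comm(2) simp del: dsum_space_sel\<close>)
qed

text \<open>At each vertex this is \<open>complement_quotient_iso\<close>. By
  \<open>part_arrows\<close> the arrows of the quotient are well defined on cosets, so the two
  vertex maps commute with the arrows.\<close>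

lemma part_complement_iso:
  assumes "I \<inter> J \<inter> J' = {}" "I \<subseteq> J \<union> J'"
  shows "kron_isomorphic (kron_sub M (part I N F J)) (kron_quot M (part I N F J'))"
proof -
  let ?P = "part I N F J" and ?K = "part I N F J'"
  have "part I N F (J \<union> J') = (carrier (space1 M), carrier (space2 M))"
    using part_cong[of "J \<union> J'" UNIV] assms(2) part_UNIV by auto
  then have ds: "fst ?P \<inter> fst ?K = {\<zero>\<^bsub>space1 M\<^esub>}" "snd ?P \<inter> snd ?K = {\<zero>\<^bsub>space2 M\<^esub>}"
    "fst ?P <+>\<^bsub>space1 M\<^esub> fst ?K = carrier (space1 M)" "snd ?P <+>\<^bsub>space2 M\<^esub> snd ?K = carrier (space2 M)"
    using part_direct_sum[OF assms(1)] unfolding kron_is_direct_sum_def by auto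
  note q1 = complement_quotient_iso[OF part_submodule(1) part_submodule(1) ds(1,3)]
  note q2 = complement_quotient_iso[OF part_submodule(2) part_submodule(2) ds(2,4)]
  let ?f1 = "\<lambda>x\<in>fst ?P. fst ?K +>\<^bsub>space1 M\<^esub> x" and ?f2 = "\<lambda>y\<in>snd ?P. snd ?K +>\<^bsub>space2 M\<^esub> y"
  have sub: "space1 (kron_sub M ?P) = (space1 M)\<lparr>carrier := fst ?P\<rparr>"
    "space2 (kron_sub M ?P) = (space2 M)\<lparr>carrier := snd ?P\<rparr>"
    "alpha (kron_sub M ?P) = alpha M" "beta (kron_sub M ?P) = beta M"
    by (simp_all add: kron_sub_def)
  have quot: "space1 (kron_quot M ?K) = quot_space (space1 M) (fst ?K)"
    "space2 (kron_quot M ?K) = quot_space (space2 M) (snd ?K)"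
    by (simp_all add: kron_quot_def)
  have lift: "alpha (kron_quot M ?K) (fst ?K +>\<^bsub>space1 M\<^esub> x) = snd ?K +>\<^bsub>space2 M\<^esub> alpha M x"
    "beta (kron_quot M ?K) (fst ?K +>\<^bsub>space1 M\<^esub> x) = snd ?K +>\<^bsub>space2 M\<^esub> beta M x"
    if "x \<in> carrier (space1 M)" for x
    unfolding kron_quot_def kronecker.simps
    by (rule coset_lift[OF part_submodule(1) part_submodule(2) that
          module_homD(2)[OF kron_moduleD(3)[OF M]] kron_moduleD(5)[OF M] part_arrows(1)], assumption+)
      (rule coset_lift[OF part_submodule(1) part_submodule(2) that
          module_homD(2)[OF kron_moduleD(4)[OF M]] kron_moduleD(6)[OF M] part_arrows(2)], assumption+)
  have Pc: "x \<in> carrier (space1 M)" if "x \<in> fst ?P" for x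
    using submodule.subset[OF part_submodule(1)] that by blast
  have "(?f1, ?f2) \<in> kron_hom (kron_sub M ?P) (kron_quot M ?K)"
  proof (rule kron_homI)
    fix x assume "x \<in> carrier (space1 (kron_sub M ?P))"
    then have x: "x \<in> fst ?P" by (simp add: sub)
    show "?f2 (alpha (kron_sub M ?P) x) = alpha (kron_quot M ?K) (?f1 x)"
      "?f2 (beta (kron_sub M ?P) x) = beta (kron_quot M ?K) (?f1 x)"
      using x part_arrows[OF x] lift[OF Pc[OF x]] by (simp_all add: sub)
  qed (use q1(1) q2(1) in \<open>simp_all add: sub quot\<close>)
  moreover have "bij_betw ?f1 (carrier (space1 (kron_sub M ?P))) (carrier (space1 (kron_quot M ?K)))"
    "bij_betw ?f2 (carrier (space2 (kron_sub M ?P))) (carrier (space2 (kron_quot M ?K)))"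
    using q1(2) q2(2) by (simp_all add: sub quot)
  ultimately have "(?f1, ?f2) \<in> kron_iso (kron_sub M ?P) (kron_quot M ?K)"
    by (simp add: kron_iso_def)
  then show ?thesis unfolding kron_isomorphic_def by blast
qed

text \<open>The i-th coordinate of the inverse of \<open>F\<close>. Every homomorphism out of M that
  is constructed below passes through such a map.\<close>

lemma component_hom:
  assumes "i \<in> I"
  obtains p where "p \<in> kron_hom M (N i)"
    "\<And>x. x \<in> carrier (dsum_space I V1) \<Longrightarrow> fst p (fst F x) = x i"
    "\<And>y. y \<in> carrier (dsum_space I V2) \<Longrightarrow> snd p (snd F y) = y i"
proof -
  note G = kron_hom_inverse[OF D M F]
  note p = kron_hom_comp[OF M G kron_hom_proj[OF N assms]]
  have "inv_into (carrier (dsum_space I V1)) (fst F) (fst F x) = x" "fst F x \<in> carrier (space1 M)"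
    if "x \<in> carrier (dsum_space I V1)" for x
    using bij_betw_inv_into_left[OF F_bij(1) that] bij_betwE[OF F_bij(1)] that by blast+
  moreover have "inv_into (carrier (dsum_space I V2)) (snd F) (snd F y) = y" "snd F y \<in> carrier (space2 M)"
    if "y \<in> carrier (dsum_space I V2)" for y
    using bij_betw_inv_into_left[OF F_bij(2) that] bij_betwE[OF F_bij(2)] that by blast+
  ultimately show ?thesis
    using that[OF p] by (simp del: dsum_space_sel)
qed

end

lemma surj_module_hom_dim_le:
  fixes K (structure)
  assumes "vectorspace K V" "vectorspace K W" "vectorspace.fin_dim K V" "h \<in> module_hom K V W"
    and "h ` carrier V = carrier W"
  shows "vectorspace.dim K W \<le> vectorspace.dim K V"
proof -
  interpret V: vectorspace K V by fact
  interpret W: vectorspace K W by fact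
  interpret linear_map K V W h
    by (intro linear_map.intro mod_hom.intro mod_hom_axioms.intro assms V.module_axioms W.module_axioms)
  have "vectorspace.dim K (W.vs imT) + vectorspace.dim K (V.vs kerT) = V.dim"
    by (rule rank_nullity[OF assms(3)])
  moreover have "imT = carrier W" using assms(5) by (simp add: im_def)
  ultimately show ?thesis by simp
qed

section \<open>Kernels of the homomorphisms into a preprojective module\<close>

text \<open>The disjunction stands outside the quantifiers: one and the same arrow has to be onto at
  all indices in \<open>J\<close>, because only then is it onto on the whole part, as
  \<open>hom_to_preproj_eq_zero\<close> requires.\<close>

lemma (in kron_decomposition) part_hom_to_preproj_eq_zero:
  assumes surj: "(\<forall>i\<in>I \<inter> J. carrier (V2 i) \<subseteq> alpha (N i) ` carrier (V1 i)) \<or>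
      (\<forall>i\<in>I \<inter> J. carrier (V2 i) \<subseteq> beta (N i) ` carrier (V1 i))"
    and g: "g \<in> kron_hom M (mat_kron (preproj m))"
  shows "\<forall>x\<in>fst (part I N F J). fst g x = 0\<^sub>v (m - 1)" and "\<forall>y\<in>snd (part I N F J). snd g y = 0\<^sub>v m"
proof -
  note g = kron_homD[OF g]
  have dims: "dim_col (fst (preproj m :: 'a mat \<times> 'a mat)) = m - 1"
    "dim_row (fst (preproj m :: 'a mat \<times> 'a mat)) = m"
    by (simp_all add: preproj_def)
  have sub: "x \<in> carrier (space1 M)" if "x \<in> fst (part I N F J)" for x
    using submodule.subset[OF part_submodule(1)] that by blast
  have sub2: "y \<in> carrier (space2 M)" if "y \<in> snd (part I N F J)" for y
    using submodule.subset[OF part_submodule(2)] that by blast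
  have surj: "snd (part I N F J) \<subseteq> alpha M ` fst (part I N F J) \<or>
      snd (part I N F J) \<subseteq> beta M ` fst (part I N F J)"
    using surj
  proof (elim disjE)
    assume "\<forall>i\<in>I \<inter> J. carrier (V2 i) \<subseteq> alpha (N i) ` carrier (V1 i)"
    then show ?thesis by (intro disjI1 part_surj(1)) (rule bspec)
  next
    assume "\<forall>i\<in>I \<inter> J. carrier (V2 i) \<subseteq> beta (N i) ` carrier (V1 i)"
    then show ?thesis by (intro disjI2 part_surj(2)) (rule bspec)
  qed
  have 1: "fst g x \<in> carrier_vec (m - 1)" if "x \<in> fst (part I N F J)" for x
    using module_homD(1)[OF g(1) sub[OF that]] by (simp only: mat_kron_sel dims module_vec_simps)
  have 2: "snd g y \<in> carrier_vec m" if "y \<in> snd (part I N F J)" for y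
    using module_homD(1)[OF g(3) sub2[OF that]] by (simp only: mat_kron_sel dims module_vec_simps)
  note * = hom_to_preproj_eq_zero[of "fst (part I N F J)" "fst g" m "snd (part I N F J)" "snd g" "alpha M" "beta M",
      OF 1 2 part_arrows _ _ surj]
  show "\<forall>x\<in>fst (part I N F J). fst g x = 0\<^sub>v (m - 1)"
    by (rule *(1)) (simp_all only: g(5,6)[OF sub] mat_kron_sel)
  show "\<forall>y\<in>snd (part I N F J). snd g y = 0\<^sub>v m"
    by (rule *(2)) (simp_all only: g(5,6)[OF sub] mat_kron_sel)
qed

text \<open>The component map is onto at vertex 2, so rank-nullity applies. For a summand P_n, of
  dimension n at that vertex, this is the bound that lets P_n be padded into the target.\<close>

lemma (in kron_decomposition) component_dim_le:
  assumes i: "i \<in> I" and fin: "vectorspace.fin_dim class_ring (space2 M)"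
  shows "vectorspace.dim class_ring (V2 i) \<le> vectorspace.dim class_ring (space2 M)"
proof -
  obtain p where p: "p \<in> kron_hom M (N i)"
    "\<And>y. y \<in> carrier (dsum_space I V2) \<Longrightarrow> snd p (snd F y) = y i"
    using component_hom[OF i] by metis
  have zero: "\<zero>\<^bsub>V2 j\<^esub> \<in> carrier (V2 j)" if "j \<in> I" for j
    using abelian_monoid.zero_closed abelian_group.axioms(1) Module.module.axioms(2)[OF N2[OF that]] by metis
  have "v \<in> snd p ` carrier (space2 M)" if v: "v \<in> carrier (V2 i)" for v
  proof -
    \<comment> \<open>The family concentrated at \<open>i\<close> with value \<open>v\<close>; the
      component map sends its image under \<open>F\<close> back to \<open>v\<close>.\<close>
    define y where "y = (\<lambda>j\<in>I. if j = i then v else \<zero>\<^bsub>V2 j\<^esub>)"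
    have "{j \<in> I. y j \<noteq> \<zero>\<^bsub>V2 j\<^esub>} \<subseteq> {i}" by (auto simp: y_def)
    then have "finite {j \<in> I. y j \<noteq> \<zero>\<^bsub>V2 j\<^esub>}" by (rule finite_subset) simp
    moreover have "y \<in> (\<Pi>\<^sub>E j\<in>I. carrier (V2 j))"
      using v zero by (auto simp: y_def)
    ultimately have y: "y \<in> carrier (dsum_space I V2)" by simp
    have "snd p (snd F y) = v" using p(2)[OF y] i by (simp add: y_def)
    then show ?thesis using bij_betwE[OF F_bij(2)] y by blast
  qed
  then have "snd p ` carrier (space2 M) = carrier (V2 i)"
    using module_homD(1)[OF kron_homD(3)[OF p(1)]] by blast
  then show ?thesis
    using M N[OF i] unfolding kron_module_def
    by (intro surj_module_hom_dim_le[OF _ _ fin kron_homD(3)[OF p(1)]]) blast+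
qed

text \<open>Vanishing on the part over \<open>- J\<close> is proved on two subparts, one for each
  arrow, and added up. Conversely, a coordinate at an index in \<open>J\<close> is detected by a
  homomorphism, so a point of the common kernel has no such coordinates.\<close>

lemma common_kernel_eq_part:
  fixes N :: "'i \<Rightarrow> ('a::field, 'a vec, 'a vec) kronecker" and M :: "('a, 'w, 'x) kronecker"
  assumes "kron_decomposition I N M F"
    and preproj: "\<And>i. i \<in> I \<inter> J \<Longrightarrow> \<exists>n\<le>m. N i = mat_kron (preproj n)"
    and surj: "\<And>i. i \<in> I - J \<Longrightarrow> carrier (space2 (N i)) \<subseteq> alpha (N i) ` carrier (space1 (N i)) \<or>
      carrier (space2 (N i)) \<subseteq> beta (N i) ` carrier (space1 (N i))"
  shows "({x \<in> carrier (space1 M). \<forall>g\<in>kron_hom M (mat_kron (preproj m)). fst g x = 0\<^sub>v (m - 1)},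
      {y \<in> carrier (space2 M). \<forall>g\<in>kron_hom M (mat_kron (preproj m)). snd g y = 0\<^sub>v m}) = part I N F (- J)"
proof -
  interpret kron_decomposition I N M F by fact
  \<comment> \<open>Indices where both arrows are onto, such as those of I_n, are put into
    \<open>A\<close>; at every index in \<open>B\<close> the arrow \<open>beta\<close> is onto by
    \<open>surj\<close>.\<close>
  define A where "A = {i \<in> I - J. carrier (V2 i) \<subseteq> alpha (N i) ` carrier (V1 i)}"
  define B where "B = I - J - A"
  have dims: "dim_col (fst (preproj k :: 'a mat \<times> 'a mat)) = k - 1"
    "dim_row (fst (preproj k :: 'a mat \<times> 'a mat)) = k" for k
    by (simp_all add: preproj_def)
  have "I \<inter> - J = I \<inter> (A \<union> B)" by (auto simp: A_def B_def)
  then have "part I N F (- J) = part I N F (A \<union> B)" by (rule part_cong)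
  moreover have "I \<inter> A \<inter> B = {}" by (auto simp: B_def)
  ultimately have ds: "kron_is_direct_sum M (part I N F (- J)) (part I N F A) (part I N F B)"
    using part_direct_sum[of A B] by argo
  have surjA: "(\<forall>i\<in>I \<inter> A. carrier (V2 i) \<subseteq> alpha (N i) ` carrier (V1 i)) \<or>
      (\<forall>i\<in>I \<inter> A. carrier (V2 i) \<subseteq> beta (N i) ` carrier (V1 i))"
    unfolding A_def by blast
  have surjB: "(\<forall>i\<in>I \<inter> B. carrier (V2 i) \<subseteq> alpha (N i) ` carrier (V1 i)) \<or>
      (\<forall>i\<in>I \<inter> B. carrier (V2 i) \<subseteq> beta (N i) ` carrier (V1 i))"
    using surj unfolding A_def B_def by blast
  have c: "fst (part I N F C) \<subseteq> carrier (space1 M)" "snd (part I N F C) \<subseteq> carrier (space2 M)" for C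
    by (rule submodule.subset[OF part_submodule(1)], rule submodule.subset[OF part_submodule(2)])
  have vanish1: "fst g x = 0\<^sub>v (m - 1)"
    if g: "g \<in> kron_hom M (mat_kron (preproj m))" and x: "x \<in> fst (part I N F (- J))" for g x
  proof -
    obtain u v where uv: "u \<in> fst (part I N F A)" "v \<in> fst (part I N F B)" "x = u \<oplus>\<^bsub>space1 M\<^esub> v"
      using ds x unfolding kron_is_direct_sum_def set_add_def' by auto
    have "fst g x = fst g u + fst g v"
      using module_homD(2)[OF kron_homD(1)[OF g] subsetD[OF c(1) uv(1)] subsetD[OF c(1) uv(2)]] uv(3)
      by (simp add: module_vec_simps)
    then show ?thesis
      using part_hom_to_preproj_eq_zero(1)[OF surjA g] part_hom_to_preproj_eq_zero(1)[OF surjB g] uv by simp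
  qed
  have vanish2: "snd g x = 0\<^sub>v m"
    if g: "g \<in> kron_hom M (mat_kron (preproj m))" and x: "x \<in> snd (part I N F (- J))" for g x
  proof -
    obtain u v where uv: "u \<in> snd (part I N F A)" "v \<in> snd (part I N F B)" "x = u \<oplus>\<^bsub>space2 M\<^esub> v"
      using ds x unfolding kron_is_direct_sum_def set_add_def' by auto
    have "snd g x = snd g u + snd g v"
      using module_homD(2)[OF kron_homD(3)[OF g] subsetD[OF c(2) uv(1)] subsetD[OF c(2) uv(2)]] uv(3)
      by (simp add: module_vec_simps)
    then show ?thesis
      using part_hom_to_preproj_eq_zero(2)[OF surjA g] part_hom_to_preproj_eq_zero(2)[OF surjB g] uv by simp
  qed
  \<comment> \<open>One test homomorphism per index suffices: padding is injective, so its vanishing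
    after the component map forces coordinate \<open>i\<close> to vanish, at both vertices.\<close>
  have separate: "(\<forall>x\<in>carrier (dsum_space I V1).
        (\<forall>g\<in>kron_hom M (mat_kron (preproj m)). fst g (fst F x) = 0\<^sub>v (m - 1)) \<longrightarrow> x i = \<zero>\<^bsub>V1 i\<^esub>) \<and>
      (\<forall>y\<in>carrier (dsum_space I V2).
        (\<forall>g\<in>kron_hom M (mat_kron (preproj m)). snd g (snd F y) = 0\<^sub>v m) \<longrightarrow> y i = \<zero>\<^bsub>V2 i\<^esub>)"
    if i: "i \<in> I" "i \<in> J" for i
  proof -
    obtain n where n: "n \<le> m" "N i = mat_kron (preproj n)" using preproj i by blast
    obtain p where p: "p \<in> kron_hom M (N i)"
      "\<And>x. x \<in> carrier (dsum_space I V1) \<Longrightarrow> fst p (fst F x) = x i"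
      "\<And>y. y \<in> carrier (dsum_space I V2) \<Longrightarrow> snd p (snd F y) = y i"
      using component_hom[OF i(1)] by metis
    note g = kron_hom_comp[OF M p(1)[unfolded n(2)] pad_vec_kron_hom[OF n(1)]]
    have V: "carrier (V1 i) = carrier_vec (n - 1)" "\<zero>\<^bsub>V1 i\<^esub> = 0\<^sub>v (n - 1)"
      "carrier (V2 i) = carrier_vec n" "\<zero>\<^bsub>V2 i\<^esub> = 0\<^sub>v n"
      by (simp_all only: n(2) mat_kron_sel dims module_vec_simps)
    have P: "carrier (space1 (mat_kron (preproj n :: 'a mat \<times> 'a mat))) = carrier_vec (n - 1)"
      "carrier (space2 (mat_kron (preproj n :: 'a mat \<times> 'a mat))) = carrier_vec n"
      by (simp_all only: mat_kron_sel dims module_vec_simps)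
    have "x i = 0\<^sub>v (n - 1)"
      if x: "x \<in> carrier (dsum_space I V1)"
        and van: "\<forall>g\<in>kron_hom M (mat_kron (preproj m)). fst g (fst F x) = 0\<^sub>v (m - 1)" for x
    proof (rule pad_vec_eq_zero)
      show xi: "x i \<in> carrier_vec (n - 1)" using x i(1) V(1) by auto
      have "fst F x \<in> carrier (space1 M)" using bij_betwE[OF F_bij(1)] x by blast
      then show "pad_vec (m - 1) (x i) = 0\<^sub>v (m - 1)"
        using bspec[OF van g] xi p(2)[OF x] P by simp
    qed (use n in simp)
    moreover have "y i = 0\<^sub>v n"
      if y: "y \<in> carrier (dsum_space I V2)"
        and van: "\<forall>g\<in>kron_hom M (mat_kron (preproj m)). snd g (snd F y) = 0\<^sub>v m" for y
    proof (rule pad_vec_eq_zero)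
      show yi: "y i \<in> carrier_vec n" using y i(1) V(3) by auto
      have "snd F y \<in> carrier (space2 M)" using bij_betwE[OF F_bij(2)] y by blast
      then show "pad_vec m (y i) = 0\<^sub>v m"
        using bspec[OF van g] yi p(3)[OF y] P by simp
    qed (rule n)
    ultimately show ?thesis unfolding V by blast
  qed
  have "{x \<in> carrier (space1 M). \<forall>g\<in>kron_hom M (mat_kron (preproj m)). fst g x = 0\<^sub>v (m - 1)}
      = fst (part I N F (- J))"
  proof (intro equalityI subsetI CollectI)
    fix z assume z: "z \<in> {x \<in> carrier (space1 M). \<forall>g\<in>kron_hom M (mat_kron (preproj m)). fst g x = 0\<^sub>v (m - 1)}"
    then obtain x where x: "x \<in> carrier (dsum_space I V1)" "z = fst F x"
      using bij_betw_imp_surj_on[OF F_bij(1)] by blast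
    have "\<forall>i\<in>I. i \<notin> - J \<longrightarrow> x i = \<zero>\<^bsub>V1 i\<^esub>"
      using separate x z by blast
    then show "z \<in> fst (part I N F (- J))"
      using x unfolding part_def supported_def fst_conv by blast
  qed (use vanish1 c(1) in blast)
  moreover have "{y \<in> carrier (space2 M). \<forall>g\<in>kron_hom M (mat_kron (preproj m)). snd g y = 0\<^sub>v m}
      = snd (part I N F (- J))"
  proof (intro equalityI subsetI CollectI)
    fix z assume z: "z \<in> {y \<in> carrier (space2 M). \<forall>g\<in>kron_hom M (mat_kron (preproj m)). snd g y = 0\<^sub>v m}"
    then obtain y where y: "y \<in> carrier (dsum_space I V2)" "z = snd F y"
      using bij_betw_imp_surj_on[OF F_bij(2)] by blast
    have "\<forall>i\<in>I. i \<notin> - J \<longrightarrow> y i = \<zero>\<^bsub>V2 i\<^esub>"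
      using separate y z by blast
    then show "z \<in> snd (part I N F (- J))"
      using y unfolding part_def supported_def snd_conv by blast
  qed (use vanish2 c(2) in blast)
  ultimately show ?thesis by (simp add: prod_eq_iff)
qed

section \<open>The three classes of indecomposables\<close>

lemma nonpreproj_arrow_surj:
  fixes L :: "'a::field mat \<times> 'a mat"
  assumes "L \<in> regulars \<union> preinjectives"
  shows "carrier (space2 (mat_kron L)) \<subseteq> alpha (mat_kron L) ` carrier (space1 (mat_kron L)) \<or>
    carrier (space2 (mat_kron L)) \<subseteq> beta (mat_kron L) ` carrier (space1 (mat_kron L))"
proof -
  consider n c where "L = regular n c" | n where "L = regular_inf n" | n where "L = preinj n"
    using assms unfolding regulars_def preinjectives_def by blast
  then show ?thesis
  proof cases
    case 1
    have "carrier_vec n \<subseteq> (*\<^sub>v) (1\<^sub>m n) ` (carrier_vec n :: 'a vec set)" by force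
    then show ?thesis unfolding 1 by (simp add: regular_def module_vec_simps)
  next
    case 2
    have "carrier_vec n \<subseteq> (*\<^sub>v) (1\<^sub>m n) ` (carrier_vec n :: 'a vec set)" by force
    then show ?thesis unfolding 2 by (simp add: regular_inf_def module_vec_simps)
  next
    case 3
    \<comment> \<open>The matrix [E 0] ignores the last entry, so padding by a zero gives a right
      inverse.\<close>
    have "v \<in> (*\<^sub>v) (fst (preinj n)) ` carrier_vec n" if v: "v \<in> carrier_vec (n - 1)" for v :: "'a vec"
    proof (rule image_eqI)
      show "v = fst (preinj n) *\<^sub>v pad_vec n v"
      proof (rule eq_vecI)
        fix i assume "i < dim_vec (fst (preinj n) *\<^sub>v pad_vec n v)"
        then have i: "i < n - 1" by (simp add: preinj_def)
        have "(fst (preinj n) *\<^sub>v pad_vec n v) $ i = (\<Sum>j\<in>{0..<n}. (if i = j then 1 else 0) * pad_vec n v $ j)"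
          using i by (simp add: preinj_def scalar_prod_def del: pad_vec_simps(3))
        also have "\<dots> = (\<Sum>j\<in>{0..<n}. if i = j then pad_vec n v $ j else 0)"
          by (intro sum.cong) auto
        also have "\<dots> = v $ i" using i v by simp
        finally show "v $ i = (fst (preinj n) *\<^sub>v pad_vec n v) $ i" by simp
      qed (use v in \<open>simp add: preinj_def\<close>)
    qed simp
    then show ?thesis unfolding 3 by (auto simp: preinj_def module_vec_simps)
  qed
qed

text \<open>The difference of columns and rows separates the classes: it is -1 for P_n, 0 for the
  regular modules and 1 for I_n. Here n \<ge> 1 matters, since for n = 0 all these matrices would be
  0 by 0.\<close>

lemma indecomposables_disjoint:
  "(preprojectives :: ('a::field mat \<times> 'a mat) set) \<inter> (regulars \<union> preinjectives) = {}"
  "(regulars :: ('a mat \<times> 'a mat) set) \<inter> preinjectives = {}"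
proof -
  let ?r = "\<lambda>L :: 'a mat \<times> 'a mat. dim_row (fst L)" and ?c = "\<lambda>L :: 'a mat \<times> 'a mat. dim_col (fst L)"
  have P: "?c L < ?r L" if "L \<in> preprojectives" for L
    using that by (auto simp: preprojectives_def preproj_def)
  have R: "?c L = ?r L" if "L \<in> regulars" for L
    using that by (auto simp: regulars_def regular_def regular_inf_def)
  have I: "?r L < ?c L" if "L \<in> preinjectives" for L
    using that by (auto simp: preinjectives_def preinj_def)
  show "(preprojectives :: ('a mat \<times> 'a mat) set) \<inter> (regulars \<union> preinjectives) = {}"
    "(regulars :: ('a mat \<times> 'a mat) set) \<inter> preinjectives = {}"
    using P R I by fastforce+
qed

lemma part_of_eq_part:
  "part_of d F S = part (summands d) (\<lambda>(L, j). mat_kron L) F {(L, j). L \<in> S}"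
  unfolding part_of_def part_def supported_def mult_dsum_def by (simp add: case_prod_unfold)

theorem proposition5p2:
  fixes M :: "('a::alg_closed_field, 'u, 'v) kronecker"
    and d1 d2 a :: nat
    and d :: "'a mat \<times> 'a mat \<Rightarrow> nat"
    and F :: "((('a mat \<times> 'a mat) \<times> nat \<Rightarrow> 'a vec) \<Rightarrow> 'u) \<times> ((('a mat \<times> 'a mat) \<times> nat \<Rightarrow> 'a vec) \<Rightarrow> 'v)"
    and f :: "nat \<Rightarrow> ('u \<Rightarrow> 'a vec) \<times> ('v \<Rightarrow> 'a vec)"
  assumes "kron_module M" and "kron_fin_dim M" and "dim_vector M = (d1, d2)"
    and "F \<in> kron_iso (mult_dsum d) M"
    and "inj_on f {1..a}"
    and "vectorspace.basis class_ring (kron_hom_space M (mat_kron (preproj d2))) (f ` {1..a})"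
  shows "let K = kron_Inter M {1..a} (\<lambda>i. kron_ker M (mat_kron (preproj d2)) (f i)) in
           kron_is_direct_sum M K (part_of d F regulars) (part_of d F preinjectives) \<and>
           kron_isomorphic (kron_sub M (part_of d F preprojectives)) (kron_quot M K)"
proof -
  let ?I = "summands d" and ?N = "\<lambda>(L, j :: nat). mat_kron (L :: 'a mat \<times> 'a mat)"
  let ?J = "\<lambda>S :: ('a mat \<times> 'a mat) set. {(L, j :: nat). L \<in> S}"
  let ?K = "part ?I ?N F (- ?J preprojectives)"
  have dec: "kron_decomposition ?I ?N M F"
    using assms(1,4) indecomposable_kron_module
    by (intro kron_decomposition.intro) (auto simp: summands_def mult_dsum_def)
  interpret kron_decomposition ?I ?N M F by (rule dec)
  have "kron_Inter M {1..a} (\<lambda>i. kron_ker M (mat_kron (preproj d2)) (f i)) =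
    ({x \<in> carrier (space1 M). \<forall>g\<in>kron_hom M (mat_kron (preproj d2)). fst g x = 0\<^sub>v (d2 - 1)},
     {y \<in> carrier (space2 M). \<forall>g\<in>kron_hom M (mat_kron (preproj d2)). snd g y = 0\<^sub>v d2})"
    using kron_Inter_ker_basis[OF assms(1) preproj_kron_module assms(6)]
    by (simp add: preproj_def module_vec_simps)
  also have "\<dots> = ?K"
  proof (rule common_kernel_eq_part[OF dec])
    fix i assume i: "i \<in> ?I \<inter> ?J preprojectives"
    then obtain n j where n: "i = (preproj n, j)" by (auto simp: preprojectives_def)
    \<comment> \<open>Vertex 2 is the right one to compare: P_n has dimension n there, which gives n
      \<le> d2 directly.\<close>
    have "vectorspace.dim class_ring (space2 (?N i)) \<le> vectorspace.dim class_ring (space2 M)"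
      using i assms(2) by (intro component_dim_le) (auto simp: kron_fin_dim_def)
    moreover have "space2 (?N i) = module_vec TYPE('a) n"
      by (simp add: n preproj_def)
    ultimately have "n \<le> d2"
      using assms(3) vec_space.dim_is_n[where 'a='a, of n] by (simp add: dim_vector_def)
    then show "\<exists>n\<le>d2. ?N i = mat_kron (preproj n)" using n by auto
  next
    fix i assume "i \<in> ?I - ?J preprojectives"
    then have "fst i \<in> regulars \<union> preinjectives" by (auto simp: summands_def indecomposables_def)
    from nonpreproj_arrow_surj[OF this]
    show "carrier (space2 (?N i)) \<subseteq> alpha (?N i) ` carrier (space1 (?N i)) \<or>
        carrier (space2 (?N i)) \<subseteq> beta (?N i) ` carrier (space1 (?N i))"
      by (simp add: case_prod_unfold)
  qed
  finally have K: "kron_Inter M {1..a} (\<lambda>i. kron_ker M (mat_kron (preproj d2)) (f i)) = ?K" .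
  \<comment> \<open>The complement contains pairs whose first entry is no indecomposable at all, but
    \<open>part\<close> sees only indices in \<open>summands d\<close>, and these are regular or
    preinjective once they are not preprojective.\<close>
  have "?I \<inter> - ?J preprojectives = ?I \<inter> (?J regulars \<union> ?J preinjectives)"
    using indecomposables_disjoint(1)[where 'a='a] by (auto simp: summands_def indecomposables_def)
  then have "?K = part ?I ?N F (?J regulars \<union> ?J preinjectives)" by (rule part_cong)
  moreover have "?I \<inter> ?J regulars \<inter> ?J preinjectives = {}"
    using indecomposables_disjoint(2)[where 'a='a] by auto
  ultimately have "kron_is_direct_sum M ?K (part_of d F regulars) (part_of d F preinjectives)"
    using part_direct_sum unfolding part_of_eq_part by metis
  \<comment> \<open>The kernel is the part over the full complement of the preprojective indices, so
    both index conditions are plain set algebra.\<close>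
  moreover have "kron_isomorphic (kron_sub M (part_of d F preprojectives)) (kron_quot M ?K)"
    unfolding part_of_eq_part by (rule part_complement_iso) auto
  ultimately show ?thesis unfolding K Let_def by blast
qed

end
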